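(* There exists a constant $c_2 > 0$ such that $$s(n) = O\left(\frac{n^2}{(\log n)^{c_2}}\right),$$ i.e. there is a constant $K>0$ with $s(n) \le K n^2 (\log n)^{-c_2}$ for all sufficiently large $n$.
   Context: A skew corner is a configuration of points of the form $(x,y),(x,y+d),(x+d,y')$ with $x,y,y',d \in \mathbb{Z}$; it is non-trivial if $d \neq 0$. A subset of $\mathbb{Z}^2$ is skew corner-free if it contains no non-trivial skew corner. For a positive integer $n$, $[n]=\{1,\dots,n\}$ and $s(n)$ denotes the largest size of a skew corner-free subset of $[n]^2$. *)

theory Defs
  imports Complex_Main "HOL-Library.Landau_Symbols"
begin

definition skew_corner :: "int \<Rightarrow> int \<Rightarrow> int \<Rightarrow> int \<Rightarrow> (int \<times> int) set" where
  "skew_corner x y y' d = {(x, y), (x, y + d), (x + d, y')}"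

definition skew_corner_free :: "(int \<times> int) set \<Rightarrow> bool" where
  "skew_corner_free A \<longleftrightarrow> \<not> (\<exists>x y y' d. d \<noteq> 0 \<and> skew_corner x y y' d \<subseteq> A)"

definition max_skew_corner_free :: "nat \<Rightarrow> nat" where
  "max_skew_corner_free n =
     Max (card ` {A. A \<subseteq> {1..int n} \<times> {1..int n} \<and> skew_corner_free A})"

text \<open>The maximum is taken over a finite nonempty set, so it is attained.\<close>

lemma finite_skew_corner_free_subsets:
  "finite {A. A \<subseteq> {1..int n} \<times> {1..int n} \<and> skew_corner_free A}"
  by (rule finite_subset[of _ "Pow ({1..int n} \<times> {1..int n})"]) auto

lemma skew_corner_free_empty: "skew_corner_free {}"
  by (simp add: skew_corner_free_def skew_corner_def)

end

theory Submission
  imports Defs "HOL-Library.FuncSet"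
begin

text \<open>
  If \<open>A\<close> is skew corner-free, let \<open>X\<close> be the set of abscissae of its popular columns and \<open>B x\<close> the
  column over \<open>x\<close>. Then for \<open>x \<in> X\<close> no non-zero element of \<open>B x - B x\<close> lies in \<open>X - x\<close>.
  Since the Fourier transform of the autocorrelation of \<open>B x\<close> is non-negative, this forces a large
  Fourier coefficient of \<open>X\<close> near \<open>x\<close>, and hence a density increment of \<open>X\<close> on a narrower Bohr set
  with one more frequency. The sets \<open>B x\<close> never have to be localised, so their density is not
  lost. After polynomially many steps (in the inverse density) the density of \<open>X\<close> would exceed 1,
  and each step costs only a polynomial factor in the radius, which gives a bound by a power of the logarithm.

  Bohr sets are replaced by the weights \<open>w t = exp (- K * (\<Sum>r\<in>R. 1 - cos (2 * pi * r * t / N)))\<close>, which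
  are positive definite and vary slowly at every scale, so that no regularity of Bohr sets is needed.
\<close>

section \<open>Elementary inequalities for cosines, exponentials and products\<close>

lemma one_minus_cos_le: "1 - cos x \<le> x\<^sup>2 / 2" for x :: real
proof -
  have "1 - cos x = 2 * (sin (x / 2))\<^sup>2"
    using cos_double_sin[of "x / 2"] by simp
  also have "\<dots> \<le> 2 * (x / 2)\<^sup>2"
    using abs_sin_x_le_abs_x[of "x / 2"] by (simp only: abs_le_square_iff)
  finally show ?thesis by (simp add: power2_eq_square)
qed

text \<open>Tangent-line bound for \<open>exp\<close>, applied at both points. With the sum
  \<open>exp x + exp y\<close> as factor, the two weights in a shifted difference can be summed
  separately, each with the deviation estimated at its own point.\<close>

lemma abs_exp_diff_le: "\<bar>exp x - exp y\<bar> \<le> (exp x + exp y) * \<bar>x - y\<bar>" for x y :: real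
proof -
  have *: "exp x - exp y \<le> exp x * (x - y)" for x y :: real
  proof -
    have "exp x * (1 + (y - x)) \<le> exp x * exp (y - x)"
      using exp_ge_add_one_self by (intro mult_left_mono) auto
    then show ?thesis by (simp add: algebra_simps exp_diff)
  qed
  have "exp x - exp y \<le> (exp x + exp y) * \<bar>x - y\<bar>" for x y :: real
  proof -
    have "exp x * (x - y) \<le> exp x * \<bar>x - y\<bar>" by (intro mult_left_mono) auto
    moreover have "exp y * \<bar>x - y\<bar> \<ge> 0" by simp
    ultimately show ?thesis using *[of x y] unfolding distrib_right by linarith
  qed
  from this[of x y] this[of y x] show ?thesis
    by (simp add: abs_le_iff abs_minus_commute add.commute)
qed

text \<open>Weighted AM-GM, from expanding a square. The free \<open>lam\<close> later trades a
  small multiple of one deviation against a large multiple of another.\<close>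

lemma abs_mult_le_weighted:
  fixes x y lam :: real
  assumes "lam > 0"
  shows "\<bar>x * y\<bar> \<le> (lam * x\<^sup>2 + y\<^sup>2 / lam) / 2"
proof -
  have "0 \<le> (lam * \<bar>x\<bar> - \<bar>y\<bar>)\<^sup>2 / lam" using assms by simp
  also have "\<dots> = lam * x\<^sup>2 + y\<^sup>2 / lam - 2 * \<bar>x * y\<bar>"
    using assms by (simp add: field_simps power2_eq_square abs_mult)
  finally show ?thesis by simp
qed

subsection \<open>Fourier analysis on cyclic groups\<close>

locale cyclic_sums =
  fixes N :: int
  assumes N_pos: "N > 0"
begin

definition periodic :: "(int \<Rightarrow> 'b) \<Rightarrow> bool" where
  "periodic f \<longleftrightarrow> (\<forall>t. f (t + N) = f t)"

lemma periodic_mod: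
  assumes "periodic f"
  shows "f (t mod N) = f t"
proof -
  have nat: "f (s + int k * N) = f s" for s k
  proof (induction k)
    case (Suc k)
    have "f (s + int (Suc k) * N) = f ((s + int k * N) + N)"
      by (simp add: algebra_simps)
    then show ?case using assms Suc by (simp add: periodic_def)
  qed simp
  show ?thesis
  proof (cases "t div N \<ge> 0")
    case True
    then have "f (t mod N + int (nat (t div N)) * N) = f t"
      by (simp add: mod_mult_div_eq algebra_simps)
    then show ?thesis by (simp only: nat)
  next
    case False
    then have "f (t + int (nat (- (t div N))) * N) = f (t mod N)"
      by (simp add: minus_mult_div_eq_mod algebra_simps)
    then show ?thesis by (simp only: nat)
  qed
qed

lemma sum_shift:
  assumes "periodic f"
  shows "(\<Sum>t\<in>{0..<N}. f (t + a)) = (\<Sum>t\<in>{0..<N}. f t)"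
proof -
  have "(\<Sum>t\<in>{0..<N}. f (t + a)) = (\<Sum>t\<in>{0..<N}. f ((t + a) mod N))"
    using assms by (simp add: periodic_mod)
  also have "\<dots> = (\<Sum>t\<in>{0..<N}. f t)"
    by (rule sum.reindex_bij_witness[where i = "\<lambda>t. (t - a) mod N" and j = "\<lambda>t. (t + a) mod N"])
       (use N_pos in \<open>auto simp: mod_simps\<close>)
  finally show ?thesis .
qed

definition chr :: "int \<Rightarrow> int \<Rightarrow> complex" where
  "chr r t = cis (2 * pi * (of_int (r * t) / of_int N))"

lemma chr_commute: "chr r t = chr t r"
  by (simp add: chr_def mult.commute)

lemma chr_add: "chr r (s + t) = chr r s * chr r t"
  by (simp add: chr_def cis_mult ring_distribs add_divide_distrib)

lemma chr_add_left: "chr (q + r) t = chr q t * chr r t"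
  by (metis chr_add chr_commute)

lemma chr_0 [simp]: "chr r 0 = 1" "chr 0 t = 1"
  by (simp_all add: chr_def)

lemma norm_chr [simp]: "norm (chr r t) = 1"
  by (simp add: chr_def)

lemma chr_minus: "chr r (- t) = cnj (chr r t)"
  by (simp add: chr_def cis_cnj)

lemma chr_minus_left: "chr (- r) t = cnj (chr r t)"
  by (metis chr_minus chr_commute)

lemma chr_eq_1_iff: "chr r 1 = 1 \<longleftrightarrow> N dvd r"
proof
  assume "chr r 1 = 1"
  then have "cos (2 * pi * (of_int r / of_int N)) = 1"
    by (auto simp: chr_def complex_eq_iff)
  then obtain k :: int where "2 * pi * (of_int r / of_int N) = of_int k * 2 * pi"
    by (auto simp: cos_one_2pi_int)
  then have "real_of_int r = of_int (k * N)"
    using N_pos by (simp add: field_simps)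
  then have "r = k * N" by linarith
  then show "N dvd r" by simp
next
  assume "N dvd r"
  then obtain k where "r = N * k" by blast
  then have "chr r 1 = cis (2 * pi * of_int k)"
    using N_pos by (simp add: chr_def)
  then show "chr r 1 = 1"
    by (simp add: cis_multiple_2pi)
qed

lemma periodic_chr: "periodic (chr r)"
proof -
  have "chr r N = chr N r" by (rule chr_commute)
  also have "\<dots> = 1"
  proof -
    have "chr N r = chr (N * r) 1" by (simp add: chr_def)
    then show ?thesis using chr_eq_1_iff by simp
  qed
  finally show ?thesis by (simp add: periodic_def chr_add)
qed

lemma sum_chr: "(\<Sum>r\<in>{0..<N}. chr r t) = (if N dvd t then of_int N else 0)"
proof (cases "N dvd t")
  case True
  have "chr r t = 1" for r
  proof -
    have "chr r t = chr (r * t) 1" by (simp add: chr_def)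
    then show ?thesis using True chr_eq_1_iff by simp
  qed
  then show ?thesis using True N_pos by simp
next
  case False
  \<comment> \<open>Shifting the summation variable by one multiplies the sum by
    \<open>chr t 1\<close>, which differs from 1, so the sum vanishes.\<close>
  have "(\<Sum>r\<in>{0..<N}. chr t r) = (\<Sum>r\<in>{0..<N}. chr t (r + 1))"
    using sum_shift[OF periodic_chr] by metis
  also have "\<dots> = (\<Sum>r\<in>{0..<N}. chr t r) * chr t 1"
    by (simp add: chr_add sum_distrib_right)
  finally have "(\<Sum>r\<in>{0..<N}. chr t r) = 0"
    using False chr_eq_1_iff by auto
  then show ?thesis using False chr_commute by simp
qed

definition ft :: "(int \<Rightarrow> complex) \<Rightarrow> int \<Rightarrow> complex" where
  "ft F r = (\<Sum>t\<in>{0..<N}. F t * chr r t)"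

lemma fourier_inversion:
  assumes "periodic F"
  shows "(\<Sum>r\<in>{0..<N}. ft F r * chr r (- s)) = of_int N * F s"
proof -
  have "(\<Sum>r\<in>{0..<N}. ft F r * chr r (- s)) =
      (\<Sum>r\<in>{0..<N}. \<Sum>t\<in>{0..<N}. F t * chr r (t - s))"
    by (simp add: ft_def sum_distrib_right mult.assoc flip: chr_add)
  also have "\<dots> = (\<Sum>t\<in>{0..<N}. \<Sum>r\<in>{0..<N}. F t * chr r (t - s))"
    by (rule sum.swap)
  also have "\<dots> = (\<Sum>t\<in>{0..<N}. if t = s mod N then F t * of_int N else 0)"
    by (intro sum.cong refl)
       (auto simp: sum_chr mod_eq_dvd_iff[symmetric] mod_pos_pos_trivial simp flip: sum_distrib_left)
  also have "\<dots> = of_int N * F s"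
    using N_pos assms by (simp add: periodic_mod mult.commute)
  finally show ?thesis .
qed

text \<open>Inverting \<open>F\<close> and summing each character over all differences
  \<open>b - b'\<close> produces a squared modulus. So the autocorrelation of \<open>B\<close>
  enters only through non-negative weights.\<close>

lemma sum_differences_ft:
  assumes "periodic F"
  shows "of_int N * (\<Sum>b\<in>B. \<Sum>b'\<in>B. F (b - b')) =
    (\<Sum>r\<in>{0..<N}. ft F r * of_real ((norm (\<Sum>b\<in>B. chr r b))\<^sup>2))"
proof -
  have sq: "(\<Sum>b\<in>B. \<Sum>b'\<in>B. chr r (- (b - b'))) = of_real ((norm (\<Sum>b\<in>B. chr r b))\<^sup>2)" for r
  proof -
    have "(\<Sum>b\<in>B. \<Sum>b'\<in>B. chr r (- (b - b'))) = (\<Sum>b\<in>B. \<Sum>b'\<in>B. cnj (chr r b) * chr r b')"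
      by (simp add: chr_minus[symmetric] chr_add[symmetric])
    also have "\<dots> = cnj (\<Sum>b\<in>B. chr r b) * (\<Sum>b\<in>B. chr r b)"
      by (simp add: sum_product)
    also have "\<dots> = of_real ((norm (\<Sum>b\<in>B. chr r b))\<^sup>2)"
      by (simp only: complex_norm_square mult.commute)
    finally show ?thesis .
  qed
  have "of_int N * (\<Sum>b\<in>B. \<Sum>b'\<in>B. F (b - b')) =
      (\<Sum>b\<in>B. \<Sum>b'\<in>B. \<Sum>r\<in>{0..<N}. ft F r * chr r (- (b - b')))"
    by (simp add: fourier_inversion[OF assms] sum_distrib_left del: minus_diff_eq)
  also have "\<dots> = (\<Sum>r\<in>{0..<N}. \<Sum>b\<in>B. \<Sum>b'\<in>B. ft F r * chr r (- (b - b')))"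
    by (simp only: sum.swap[where B = "{0..<N}"])
  also have "\<dots> = (\<Sum>r\<in>{0..<N}. ft F r * of_real ((norm (\<Sum>b\<in>B. chr r b))\<^sup>2))"
    by (simp only: sq sum_distrib_left[symmetric])
  finally show ?thesis .
qed

text \<open>Parseval for the indicator of \<open>B\<close>: apply \<open>sum_differences_ft\<close>
  to the indicator of the multiples of \<open>N\<close>, whose Fourier coefficients are all 1. As
  \<open>B\<close> lies in one period, only the diagonal pairs count.\<close>

lemma parseval_card:
  assumes "B \<subseteq> {0..<N}"
  shows "(\<Sum>r\<in>{0..<N}. (norm (\<Sum>b\<in>B. chr r b))\<^sup>2) = of_int N * real (card B)"
proof -
  define D :: "int \<Rightarrow> complex" where "D t = (if N dvd t then 1 else 0)" for t
  have per: "periodic D" by (simp add: D_def periodic_def)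
  have ftD: "ft D r = 1" for r
  proof -
    have "ft D r = (\<Sum>t\<in>{0..<N}. if t = 0 then 1 else 0)"
      unfolding ft_def D_def
      by (intro sum.cong refl) (auto dest: zdvd_imp_le)
    then show ?thesis using N_pos by simp
  qed
  have "(\<Sum>b'\<in>B. D (b - b')) = 1" if "b \<in> B" for b
  proof -
    have "(\<Sum>b'\<in>B. D (b - b')) = (\<Sum>b'\<in>B. if b' = b then 1 else 0)"
    proof (intro sum.cong refl)
      fix b' assume "b' \<in> B"
      then have "N dvd b - b' \<longleftrightarrow> b = b'"
        using that assms mod_pos_pos_trivial[of b N] mod_pos_pos_trivial[of b' N]
        by (metis atLeastLessThan_iff mod_eq_dvd_iff subsetD)
      then show "D (b - b') = (if b' = b then 1 else 0)" by (auto simp: D_def)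
    qed
    then show ?thesis using that finite_subset[OF assms] by simp
  qed
  then have "of_int N * complex_of_real (card B) =
      of_real (\<Sum>r\<in>{0..<N}. (norm (\<Sum>b\<in>B. chr r b))\<^sup>2)"
    using sum_differences_ft[OF per, of B] by (simp add: ftD)
  then show ?thesis by (metis of_real_eq_iff of_real_mult of_real_of_int_eq)
qed

text \<open>The largest coefficient is pulled out of the Fourier expansion; by Parseval the
  remaining non-negative weights add up to \<open>N * card B\<close>.\<close>

lemma large_ft_exists:
  assumes "periodic F" "B \<subseteq> {0..<N}"
  shows "\<exists>r. norm (\<Sum>b\<in>B. \<Sum>b'\<in>B. F (b - b')) \<le> norm (ft F r) * real (card B)"
proof -
  let ?M = "Max ((\<lambda>r. norm (ft F r)) ` {0..<N})"
  have M: "norm (ft F r) \<le> ?M" if "r \<in> {0..<N}" for r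
    using that by (intro Max_ge) auto
  have "?M \<in> (\<lambda>r. norm (ft F r)) ` {0..<N}"
    using N_pos by (intro Max_in) auto
  then obtain r where r: "?M = norm (ft F r)" by blast
  have "of_int N * norm (\<Sum>b\<in>B. \<Sum>b'\<in>B. F (b - b')) =
      norm (\<Sum>r\<in>{0..<N}. ft F r * of_real ((norm (\<Sum>b\<in>B. chr r b))\<^sup>2))"
    using N_pos by (simp only: sum_differences_ft[OF assms(1), symmetric]) (simp add: norm_mult)
  also have "\<dots> \<le> (\<Sum>r\<in>{0..<N}. ?M * (norm (\<Sum>b\<in>B. chr r b))\<^sup>2)"
    by (intro sum_norm_le) (auto simp: norm_mult norm_power intro!: mult_right_mono M)
  also have "\<dots> = of_int N * (?M * real (card B))"
    by (simp only: sum_distrib_left[symmetric] parseval_card[OF assms(2)]) (simp add: mult_ac)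
  finally have "norm (\<Sum>b\<in>B. \<Sum>b'\<in>B. F (b - b')) \<le> ?M * real (card B)"
    using N_pos by simp
  then show ?thesis using r by auto
qed

section \<open>Positive definite functions\<close>

text \<open>The cone spanned by the characters, that is, the periodic functions with non-negative
  Fourier transform. Generating it inductively reduces closure under products to products of
  characters.\<close>

inductive posdef :: "(int \<Rightarrow> complex) \<Rightarrow> bool" where
  chr: "posdef (chr q)"
| add: "posdef f \<Longrightarrow> posdef g \<Longrightarrow> posdef (\<lambda>t. f t + g t)"
| scale: "c \<ge> 0 \<Longrightarrow> posdef f \<Longrightarrow> posdef (\<lambda>t. of_real c * f t)"

lemma posdef_const: "c \<ge> 0 \<Longrightarrow> posdef (\<lambda>t. of_real c)"
  using posdef.scale[OF _ posdef.chr[of 0], of c] by simp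

lemma posdef_mult:
  assumes "posdef f" "posdef g"
  shows "posdef (\<lambda>t. f t * g t)"
  using assms(1)
proof induction
  case (chr q)
  show ?case using assms(2)
  proof induction
    case (chr r)
    have "chr (q + r) = (\<lambda>t. chr q t * chr r t)" by (simp add: fun_eq_iff chr_add_left)
    then show ?case using posdef.chr[of "q + r"] by simp
  next
    case (add f g)
    then show ?case using posdef.add by (simp add: ring_distribs)
  next
    case (scale c f)
    then show ?case using posdef.scale[OF scale(1) scale.IH] by (simp add: mult_ac)
  qed
next
  case (add f1 f2)
  then show ?case using posdef.add by (simp add: ring_distribs)
next
  case (scale c f)
  then show ?case using posdef.scale[OF scale(1) scale.IH] by (simp add: mult_ac)
qed

lemma posdef_power: "posdef f \<Longrightarrow> posdef (\<lambda>t. f t ^ n)"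
proof (induction n)
  case 0
  then show ?case using posdef_const[of 1] by simp
next
  case (Suc n)
  then show ?case using posdef_mult by simp
qed

lemma posdef_sum:
  "finite R \<Longrightarrow> (\<And>r. r \<in> R \<Longrightarrow> posdef (f r)) \<Longrightarrow> posdef (\<lambda>t. \<Sum>r\<in>R. f r t)"
proof (induction R rule: finite_induct)
  case empty
  then show ?case using posdef_const[of 0] by simp
next
  case (insert r R)
  then show ?case using posdef.add[of "f r"] by simp
qed

lemma posdef_Re_chr: "posdef (\<lambda>t. of_real (Re (chr r t)))"
proof -
  have "posdef (\<lambda>t. of_real (1 / 2) * (chr r t + chr (- r) t))"
    by (intro posdef.intros) simp
  moreover have "of_real (1 / 2) * (chr r t + chr (- r) t) = of_real (Re (chr r t))" for t
    by (simp add: chr_minus_left complex_add_cnj)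
  ultimately show ?thesis by simp
qed

lemma ft_posdef: "posdef f \<Longrightarrow> Im (ft f r) = 0 \<and> Re (ft f r) \<ge> 0"
proof (induction rule: posdef.induct)
  case (chr q)
  have "ft (chr q) r = (\<Sum>t\<in>{0..<N}. chr t (q + r))"
    by (simp add: ft_def chr_commute[of _ "q + r"] chr_add_left)
  then show ?case using N_pos by (simp add: sum_chr)
next
  case (add f g)
  then show ?case by (simp add: ft_def ring_distribs sum.distrib)
next
  case (scale c f)
  have "ft (\<lambda>t. of_real c * f t) r = of_real c * ft f r"
    by (simp add: ft_def sum_distrib_left mult_ac)
  then show ?case using scale by simp
qed

text \<open>\<open>exp (g t)\<close> is the limit of \<open>(1 + g t / n) ^ n\<close>, which lies in
  the cone. The transform is a finite sum, so pointwise convergence preserves the sign. The case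
  \<open>n = 0\<close> is harmless since \<open>1 / 0 = 0\<close>.\<close>

lemma ft_exp_posdef:
  assumes "posdef (\<lambda>t. of_real (g t))"
  shows "Re (ft (\<lambda>t. of_real (exp (g t))) r) \<ge> 0"
proof -
  have lim: "(\<lambda>n. Re (ft (\<lambda>t. of_real ((1 + g t / real n) ^ n)) r))
      \<longlonglongrightarrow> Re (ft (\<lambda>t. of_real (exp (g t))) r)"
    unfolding ft_def by (intro tendsto_intros tendsto_exp_limit_sequentially)
  have "Re (ft (\<lambda>t. of_real ((1 + g t / real n) ^ n)) r) \<ge> 0" for n
  proof -
    have "posdef (\<lambda>t. (of_real 1 + of_real (1 / real n) * of_real (g t)) ^ n)"
      by (intro posdef_power posdef.add posdef_const posdef.scale assms) auto
    then show ?thesis using ft_posdef[of _ r] by simp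
  qed
  then show ?thesis by (intro LIMSEQ_le_const[OF lim]) auto
qed

subsection \<open>Smooth Bohr weights\<close>

text \<open>\<open>wt K R\<close> plays the role of the indicator of a Bohr set with frequency set \<open>R\<close> and radius
  about \<open>1 / sqrt K\<close>.\<close>

definition dev :: "int set \<Rightarrow> int \<Rightarrow> real" where
  "dev R t = (\<Sum>r\<in>R. 1 - Re (chr r t))"

definition wt :: "real \<Rightarrow> int set \<Rightarrow> int \<Rightarrow> real" where
  "wt K R t = exp (- (K * dev R t))"

definition mass :: "real \<Rightarrow> int set \<Rightarrow> real" where
  "mass K R = (\<Sum>t\<in>{0..<N}. wt K R t)"

text \<open>Logarithm of the inverse relative size of the weight. It corresponds to the rank times
  the logarithm of the inverse radius of a Bohr set.\<close>

definition loss :: "real \<Rightarrow> int set \<Rightarrow> real" where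
  "loss K R = ln (of_int N / mass K R)"

lemma Re_chr_le_1: "Re (chr r t) \<le> 1"
  by (simp add: chr_def)

lemma dev_nonneg: "dev R t \<ge> 0"
  by (auto simp: dev_def Re_chr_le_1 intro!: sum_nonneg)

lemma dev_0 [simp]: "dev R 0 = 0"
  by (simp add: dev_def)

lemma dev_minus: "dev R (- t) = dev R t"
  by (simp add: dev_def chr_minus)

lemma dev_mono: "finite S \<Longrightarrow> R \<subseteq> S \<Longrightarrow> dev R t \<le> dev S t"
  by (auto simp: dev_def Re_chr_le_1 intro!: sum_mono2)

lemma periodic_wt: "periodic (wt K R)"
  using periodic_chr by (simp add: periodic_def wt_def dev_def)

lemma periodic_dev: "periodic (dev R)"
  using periodic_chr by (simp add: periodic_def dev_def)

lemma wt_pos: "wt K R t > 0"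
  by (simp add: wt_def)

lemma wt_nonneg: "wt K R t \<ge> 0"
  by (simp add: wt_def)

lemma wt_0 [simp]: "wt K R 0 = 1"
  by (simp add: wt_def)

lemma mass_pos: "mass K R > 0"
  unfolding mass_def using N_pos by (intro sum_pos) (auto simp: wt_pos)

lemma mass_le: "K \<ge> 0 \<Longrightarrow> mass K R \<le> of_int N"
  unfolding mass_def
  using sum_bounded_above[of "{0..<N}" "wt K R" 1] N_pos
  by (simp add: wt_def dev_nonneg)

lemma loss_nonneg: "K \<ge> 0 \<Longrightarrow> loss K R \<ge> 0"
  unfolding loss_def using mass_le[of K R] mass_pos[of K R] N_pos by simp

lemma mass_eq_loss: "mass K R = of_int N * exp (- loss K R)"
  unfolding loss_def using mass_pos[of K R] N_pos by (simp add: exp_minus field_simps)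

text \<open>The difference of the two sides, divided by the mass, is the relative entropy of the normalised
  weight with respect to the uniform measure.\<close>

lemma mean_dev_le_loss:
  "K * (\<Sum>t\<in>{0..<N}. wt K R t * dev R t) \<le> mass K R * loss K R"
proof -
  define L where "L = loss K R"
  \<comment> \<open>The bound \<open>1 + u \<le> exp u\<close> at
    \<open>u = K * dev R t - L\<close>: multiplied by the weight, the exponential becomes the
    constant \<open>exp (- L)\<close>, whose sum over a period is exactly the mass.\<close>
  have "wt K R t * (1 + (K * dev R t - L)) \<le> exp (- L)" for t
  proof -
    have "wt K R t * (1 + (K * dev R t - L)) \<le> wt K R t * exp (K * dev R t - L)"
      using exp_ge_add_one_self by (intro mult_left_mono) (auto simp: wt_nonneg)
    also have "\<dots> = exp (- L)" by (simp add: wt_def flip: exp_add)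
    finally show ?thesis .
  qed
  then have "(\<Sum>t\<in>{0..<N}. wt K R t * (1 + (K * dev R t - L))) \<le> (\<Sum>t\<in>{0..<N}. exp (- L))"
    by (intro sum_mono)
  also have "\<dots> = mass K R"
    using N_pos by (simp add: mass_eq_loss L_def)
  also have "(\<Sum>t\<in>{0..<N}. wt K R t * (1 + (K * dev R t - L))) =
      mass K R + K * (\<Sum>t\<in>{0..<N}. wt K R t * dev R t) - mass K R * L"
    by (simp add: mass_def algebra_simps sum.distrib sum_subtractf sum_distrib_left sum_distrib_right)
  finally show ?thesis by (simp add: L_def)
qed

section \<open>Lower bounds for the mass by the pigeonhole principle\<close>

text \<open>Dirichlet's argument: the fractional parts of \<open>r * t / N\<close> are sorted into
  \<open>m\<close> intervals for each frequency, and a most popular cell serves as \<open>T\<close>,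
  with \<open>t0\<close> any of its points.\<close>

lemma many_small_dev:
  assumes "finite R" "m > 0"
  shows "\<exists>T t0. T \<subseteq> {0..<N} \<and> real_of_int N \<le> real (card T) * real m ^ card R \<and>
    (\<forall>t\<in>T. dev R (t - t0) \<le> real (card R) * (32 / (real m)\<^sup>2))"
proof -
  define f where "f t = (\<lambda>r\<in>R. nat \<lfloor>real m * frac (of_int (r * t) / of_int N)\<rfloor>)" for t
  have "f \<in> {0..<N} \<rightarrow> (R \<rightarrow>\<^sub>E {..<m})"
  proof
    fix t
    have "nat \<lfloor>real m * frac (real_of_int (r * t) / of_int N)\<rfloor> < m" for r
    proof -
      have "real m * frac (real_of_int (r * t) / of_int N) < real m"
        using frac_lt_1 assms(2) by simp
      then show ?thesis using assms(2) by (simp add: nat_less_iff floor_less_iff)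
    qed
    then show "f t \<in> R \<rightarrow>\<^sub>E {..<m}" by (auto simp: f_def)
  qed
  then have "\<exists>y\<in>R \<rightarrow>\<^sub>E {..<m}. card (f -` {y} \<inter> {0..<N}) * card (R \<rightarrow>\<^sub>E {..<m}) \<ge> card {0..<N}"
    by (rule pigeonhole_card) (use assms in \<open>auto intro!: finite_PiE simp: PiE_eq_empty_iff\<close>)
  then obtain y where y: "card {0..<N} \<le> card (f -` {y} \<inter> {0..<N}) * m ^ card R"
    using assms by (auto simp: card_funcsetE)
  define T where "T = f -` {y} \<inter> {0..<N}"
  have card: "real_of_int N \<le> real (card T) * real m ^ card R"
  proof -
    have "real_of_int N = real (card {0..<N})" using N_pos by simp
    also have "\<dots> \<le> real (card T * m ^ card R)" using y by (simp only: T_def of_nat_le_iff)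
    finally show ?thesis by simp
  qed
  then have "T \<noteq> {}" using N_pos by auto
  then obtain t0 where t0: "t0 \<in> T" by blast
  have "dev R (t - t0) \<le> real (card R) * (32 / (real m)\<^sup>2)" if "t \<in> T" for t
  proof -
    have "1 - Re (chr r (t - t0)) \<le> 32 / (real m)\<^sup>2" if "r \<in> R" for r
    proof -
      let ?a = "real_of_int (r * t) / of_int N" and ?b = "real_of_int (r * t0) / of_int N"
      have "f t r = f t0 r" using \<open>t \<in> T\<close> t0 by (simp add: T_def)
      then have "nat \<lfloor>real m * frac ?a\<rfloor> = nat \<lfloor>real m * frac ?b\<rfloor>"
        using \<open>r \<in> R\<close> by (simp add: f_def)
      moreover have "\<lfloor>real m * frac ?a\<rfloor> \<ge> 0" "\<lfloor>real m * frac ?b\<rfloor> \<ge> 0"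
        by simp_all
      ultimately have "\<lfloor>real m * frac ?a\<rfloor> = \<lfloor>real m * frac ?b\<rfloor>" by linarith
      then have "\<bar>real m * frac ?a - real m * frac ?b\<bar> \<le> 1" by linarith
      then have "real m * \<bar>frac ?a - frac ?b\<bar> \<le> 1"
        by (simp add: abs_mult flip: right_diff_distrib)
      then have close: "\<bar>frac ?a - frac ?b\<bar> \<le> 1 / real m"
        using assms(2) by (simp add: field_simps)
      \<comment> \<open>Only the fractional parts matter: the integer parts contribute full
        turns.\<close>
      have "2 * pi * (of_int (r * (t - t0)) / of_int N) =
          2 * pi * (frac ?a - frac ?b) + 2 * pi * of_int (\<lfloor>?a\<rfloor> - \<lfloor>?b\<rfloor>)"
        by (simp add: frac_def algebra_simps diff_divide_distrib)
      then have "chr r (t - t0) = cis (2 * pi * (frac ?a - frac ?b))"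
        unfolding chr_def by (simp only: cis_mult[symmetric]) simp
      then have "1 - Re (chr r (t - t0)) \<le> (2 * pi * (frac ?a - frac ?b))\<^sup>2 / 2"
        using one_minus_cos_le by simp
      also have "\<dots> = 2 * pi\<^sup>2 * \<bar>frac ?a - frac ?b\<bar>\<^sup>2"
        by (simp add: power_mult_distrib)
      \<comment> \<open>The constant 32 comes from the crude bound \<open>pi < 4\<close> in
        \<open>2 * pi ^ 2\<close>.\<close>
      also have "\<dots> \<le> 2 * 4\<^sup>2 * (1 / real m)\<^sup>2"
        using close pi_less_4 by (intro mult_mono power_mono) auto
      finally show ?thesis by (simp add: power_divide)
    qed
    then have "dev R (t - t0) \<le> (\<Sum>r\<in>R. 32 / (real m)\<^sup>2)"
      unfolding dev_def by (intro sum_mono)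
    then show ?thesis by simp
  qed
  then show ?thesis using card unfolding T_def by blast
qed

text \<open>Translating by \<open>t0\<close> brings the popular cell to where the weight is at least
  \<open>exp (- E)\<close>. With \<open>m\<close> equal to the square root of \<open>K\<close> the
  second term is constant, and the loss is of order \<open>card R * ln m\<close>.\<close>

lemma loss_le:
  assumes "finite R" "m > 0" "K \<ge> 0"
  shows "loss K R \<le> real (card R) * (ln (real m) + 32 * K / (real m)\<^sup>2)"
proof -
  obtain T t0 where T: "T \<subseteq> {0..<N}" "real_of_int N \<le> real (card T) * real m ^ card R"
    and small: "\<And>t. t \<in> T \<Longrightarrow> dev R (t - t0) \<le> real (card R) * (32 / (real m)\<^sup>2)"
    using many_small_dev[OF assms(1,2)] by blast
  define E where "E = real (card R) * (32 * K / (real m)\<^sup>2)"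
  have "real (card T) * exp (- E) \<le> (\<Sum>t\<in>T. wt K R (t - t0))"
  proof -
    have "exp (- E) \<le> wt K R (t - t0)" if "t \<in> T" for t
      using mult_left_mono[OF small[OF that] assms(3)] by (simp add: wt_def E_def mult_ac)
    then have "(\<Sum>t\<in>T. exp (- E)) \<le> (\<Sum>t\<in>T. wt K R (t - t0))" by (intro sum_mono)
    then show ?thesis by simp
  qed
  also have "\<dots> \<le> (\<Sum>t\<in>{0..<N}. wt K R (t - t0))"
    using T(1) by (intro sum_mono2) (auto simp: wt_nonneg)
  also have "\<dots> = mass K R"
    using sum_shift[OF periodic_wt, of K R "- t0"] by (simp add: mass_def)
  finally have "real (card T) * exp (- E) \<le> mass K R" .
  then have "real (card T) * real m ^ card R \<le> mass K R * exp E * real m ^ card R"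
    by (intro mult_right_mono) (auto simp: exp_minus field_simps)
  with T(2) have "of_int N / mass K R \<le> exp E * real m ^ card R"
    using mass_pos[of K R] by (simp add: field_simps)
  then have "loss K R \<le> ln (exp E * real m ^ card R)"
    unfolding loss_def using mass_pos[of K R] N_pos assms(2) by (subst ln_le_cancel_iff) auto
  also have "\<dots> = E + real (card R) * ln (real m)"
    using assms(2) by (simp add: ln_mult ln_realpow)
  finally show ?thesis by (simp add: E_def algebra_simps)
qed

section \<open>Approximate translation invariance of the weights\<close>

text \<open>\<open>dev\<close> behaves like a squared norm, so a shift creates a cross term, here
  \<open>sin a * sin b\<close>. Weighted AM-GM splits it, and
  \<open>(sin x)^2 \<le> 2 * (1 - cos x)\<close> turns the squares back into deviations.\<close>

lemma dev_shift:
  assumes "lam > 0"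
  shows "\<bar>dev R (s + t) - dev R s\<bar> \<le> lam * dev R s + (1 + 1 / lam) * dev R t"
proof -
  have "\<bar>Re (chr r (s + t)) - Re (chr r s)\<bar>
      \<le> lam * (1 - Re (chr r s)) + (1 + 1 / lam) * (1 - Re (chr r t))" for r
  proof -
    define a b where "a = 2 * pi * (of_int (r * s) / of_int N)" and "b = 2 * pi * (of_int (r * t) / of_int N)"
    have sin2: "(sin x)\<^sup>2 \<le> 2 * (1 - cos x)" for x :: real
    proof -
      have "(1 - cos x) * (1 + cos x) \<le> (1 - cos x) * 2"
        by (intro mult_left_mono) auto
      then show ?thesis unfolding sin_squared_eq by (simp add: power2_eq_square algebra_simps)
    qed
    have "\<bar>cos (a + b) - cos a\<bar> \<le> \<bar>cos a * (1 - cos b)\<bar> + \<bar>sin a * sin b\<bar>"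
      by (simp add: cos_add algebra_simps)
    also have "\<bar>cos a * (1 - cos b)\<bar> \<le> 1 - cos b"
      by (simp add: abs_mult mult_left_le_one_le)
    also have "\<bar>sin a * sin b\<bar> \<le> (lam * (sin a)\<^sup>2 + (sin b)\<^sup>2 / lam) / 2"
      by (rule abs_mult_le_weighted[OF assms])
    also have "\<dots> \<le> (lam * (2 * (1 - cos a)) + (2 * (1 - cos b)) / lam) / 2"
      using assms sin2 by (intro divide_right_mono add_mono mult_left_mono) auto
    finally have "\<bar>cos (a + b) - cos a\<bar> \<le> lam * (1 - cos a) + (1 + 1 / lam) * (1 - cos b)"
      using assms by (simp add: field_simps)
    moreover have "chr r (s + t) = cis (a + b)"
      unfolding chr_add a_def b_def cis_mult[symmetric] by (simp only: chr_def)
    ultimately show ?thesis by (simp add: chr_def a_def b_def)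
  qed
  then have "(\<Sum>r\<in>R. \<bar>Re (chr r (s + t)) - Re (chr r s)\<bar>)
      \<le> (\<Sum>r\<in>R. lam * (1 - Re (chr r s)) + (1 + 1 / lam) * (1 - Re (chr r t)))"
    by (intro sum_mono)
  also have "\<dots> = lam * dev R s + (1 + 1 / lam) * dev R t"
    by (simp add: dev_def sum.distrib sum_distrib_left)
  finally have le: "(\<Sum>r\<in>R. \<bar>Re (chr r (s + t)) - Re (chr r s)\<bar>) \<le> lam * dev R s + (1 + 1 / lam) * dev R t" .
  have "\<bar>dev R (s + t) - dev R s\<bar> = \<bar>\<Sum>r\<in>R. (1 - Re (chr r (s + t))) - (1 - Re (chr r s))\<bar>"
    by (simp add: dev_def flip: sum_subtractf)
  also have "\<dots> \<le> (\<Sum>r\<in>R. \<bar>(1 - Re (chr r (s + t))) - (1 - Re (chr r s))\<bar>)"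
    by (rule sum_abs)
  also have "\<dots> = (\<Sum>r\<in>R. \<bar>Re (chr r (s + t)) - Re (chr r s)\<bar>)"
    by (intro sum.cong) auto
  finally show ?thesis using le by linarith
qed

text \<open>By the entropy bound \<open>mean_dev_le_loss\<close>, \<open>K * dev R s\<close> is at
  most the loss on average over the weight. Hence the relative error
  \<open>lam * K * dev R s\<close> costs only \<open>lam * loss\<close> in total.\<close>

lemma wt_shift_l1:
  assumes "lam > 0" "K \<ge> 0"
  shows "(\<Sum>s\<in>{0..<N}. \<bar>wt K R (s + t) - wt K R s\<bar>)
    \<le> 2 * mass K R * (lam * loss K R + (1 + 1 / lam) * (K * dev R t))"
proof -
  let ?c = "(1 + 1 / lam) * (K * dev R t)"
  define h where "h s = wt K R s * (lam * (K * dev R s) + ?c)" for s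
  have "\<bar>wt K R (s + t) - wt K R s\<bar> \<le> h (s + t) + h s" for s
  proof -
    let ?D = "\<bar>dev R (s + t) - dev R s\<bar>"
    have "\<bar>- (K * dev R (s + t)) - - (K * dev R s)\<bar> = K * ?D"
      using assms(2) by (simp add: abs_mult abs_minus_commute flip: right_diff_distrib)
    then have "\<bar>wt K R (s + t) - wt K R s\<bar> \<le> (wt K R (s + t) + wt K R s) * (K * ?D)"
      using abs_exp_diff_le[of "- (K * dev R (s + t))" "- (K * dev R s)"] by (simp add: wt_def)
    also have "\<dots> = wt K R (s + t) * (K * ?D) + wt K R s * (K * ?D)"
      by (simp add: algebra_simps)
    also have "\<dots> \<le> h (s + t) + h s"
      unfolding h_def
    proof (intro add_mono mult_left_mono wt_nonneg)
      have "?D \<le> lam * dev R (s + t) + (1 + 1 / lam) * dev R t"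
        using dev_shift[OF assms(1), of R "s + t" "- t"] by (simp add: dev_minus)
      from mult_left_mono[OF this assms(2)]
      show "K * ?D \<le> lam * (K * dev R (s + t)) + ?c" by (simp add: algebra_simps)
      from mult_left_mono[OF dev_shift[OF assms(1), of R s t] assms(2)]
      show "K * ?D \<le> lam * (K * dev R s) + ?c" by (simp add: algebra_simps)
    qed
    finally show ?thesis .
  qed
  then have "(\<Sum>s\<in>{0..<N}. \<bar>wt K R (s + t) - wt K R s\<bar>) \<le> (\<Sum>s\<in>{0..<N}. h (s + t) + h s)"
    by (intro sum_mono)
  also have "\<dots> = 2 * (\<Sum>s\<in>{0..<N}. h s)"
  proof -
    have "periodic h" using periodic_wt periodic_dev by (simp add: h_def periodic_def)
    then show ?thesis by (simp add: sum.distrib sum_shift)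
  qed
  also have "(\<Sum>s\<in>{0..<N}. h s) = lam * (K * (\<Sum>s\<in>{0..<N}. wt K R s * dev R s)) + mass K R * ?c"
    unfolding h_def mass_def distrib_left[of "wt K R _"] sum.distrib sum_distrib_left sum_distrib_right
    by (simp add: mult_ac)
  also have "\<dots> \<le> lam * (mass K R * loss K R) + mass K R * ?c"
    using assms(1) mean_dev_le_loss by (intro add_right_mono mult_left_mono) auto
  finally show ?thesis by (simp add: algebra_simps)
qed

text \<open>Under the finer weight, \<open>K * dev R t\<close> averages at most
  \<open>H / P^2\<close>. Taking \<open>lam = 1 / P\<close> gives
  \<open>2 * (H / P + (1 + P) * H / P^2)\<close>, and \<open>1 + P \<le> 2 * P\<close> leads to the
  constant 6.\<close>

lemma wt_shift_l1_average:
  assumes "finite S" "R \<subseteq> S" "K \<ge> 0" "P \<ge> 1" "K * P\<^sup>2 \<le> K'" "loss K R \<le> H" "loss K' S \<le> H"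
  shows "(\<Sum>t\<in>{0..<N}. wt K' S t * (\<Sum>s\<in>{0..<N}. \<bar>wt K R (s + t) - wt K R s\<bar>))
    \<le> 6 * H / P * (mass K R * mass K' S)"
proof -
  let ?W = "mass K R" and ?V = "mass K' S"
  have "H \<ge> 0" using loss_nonneg[OF assms(3)] assms(6) order_trans by blast
  have "P > 0" using assms(4) by simp
  have "K' \<ge> 0" using assms(3,5) by (meson mult_nonneg_nonneg order_trans zero_le_power2)
  define d where "d = (\<Sum>t\<in>{0..<N}. wt K' S t * dev R t)"
  have d: "K * d \<le> ?V * H / P\<^sup>2"
  proof -
    have "d \<le> (\<Sum>t\<in>{0..<N}. wt K' S t * dev S t)"
      unfolding d_def using assms(1,2) by (intro sum_mono mult_left_mono dev_mono wt_nonneg)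
    then have "K' * d \<le> K' * (\<Sum>t\<in>{0..<N}. wt K' S t * dev S t)"
      using \<open>K' \<ge> 0\<close> by (rule mult_left_mono)
    also have "\<dots> \<le> ?V * loss K' S" by (rule mean_dev_le_loss)
    also have "\<dots> \<le> ?V * H" using assms(7) mass_pos[of K' S] by simp
    finally have "K' * d \<le> ?V * H" .
    moreover have "K * P\<^sup>2 * d \<le> K' * d"
      using assms(5) by (intro mult_right_mono) (auto simp: d_def dev_nonneg wt_nonneg intro!: sum_nonneg)
    ultimately have "K * d * P\<^sup>2 \<le> ?V * H" by (simp add: mult_ac)
    then show ?thesis using \<open>P > 0\<close> by (simp add: field_simps)
  qed
  have "(\<Sum>t\<in>{0..<N}. wt K' S t * (\<Sum>s\<in>{0..<N}. \<bar>wt K R (s + t) - wt K R s\<bar>))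
    \<le> (\<Sum>t\<in>{0..<N}. wt K' S t * (2 * ?W * (1 / P * H + (1 + P) * (K * dev R t))))"
  proof (intro sum_mono mult_left_mono wt_nonneg)
    fix t
    have "(\<Sum>s\<in>{0..<N}. \<bar>wt K R (s + t) - wt K R s\<bar>)
      \<le> 2 * ?W * (1 / P * loss K R + (1 + P) * (K * dev R t))"
      using wt_shift_l1[of "1 / P" K R t] \<open>P > 0\<close> assms(3) by simp
    also have "\<dots> \<le> 2 * ?W * (1 / P * H + (1 + P) * (K * dev R t))"
      using \<open>P > 0\<close> assms(6) mass_pos[of K R]
      by (intro mult_left_mono add_right_mono) auto
    finally show "(\<Sum>s\<in>{0..<N}. \<bar>wt K R (s + t) - wt K R s\<bar>) \<le> \<dots>" .
  qed
  also have "\<dots> = 2 * ?W * (?V * (H / P) + (1 + P) * (K * d))"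
    by (simp add: d_def mass_def ring_distribs sum.distrib sum_distrib_left sum_distrib_right mult_ac)
  also have "\<dots> \<le> 2 * ?W * (?V * (H / P) + (2 * P) * (?V * H / P\<^sup>2))"
  proof (intro mult_left_mono add_left_mono)
    have "(1 + P) * (K * d) \<le> (1 + P) * (?V * H / P\<^sup>2)"
      using d \<open>P > 0\<close> by (intro mult_left_mono) auto
    also have "\<dots> \<le> (2 * P) * (?V * H / P\<^sup>2)"
      using assms(4) mass_pos[of K' S] \<open>H \<ge> 0\<close> by (intro mult_right_mono) auto
    finally show "(1 + P) * (K * d) \<le> (2 * P) * (?V * H / P\<^sup>2)" .
  qed (use mass_pos[of K R] in auto)
  also have "\<dots> = 6 * H / P * (?W * ?V)"
    using \<open>P > 0\<close> by (simp add: field_simps power2_eq_square)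
  finally show ?thesis .
qed

text \<open>Takes the place of regularity of Bohr sets: a coarse average may be replaced by an
  average of fine averages. By periodicity the shift can be moved from \<open>g\<close> to the
  coarse weight, where \<open>wt_shift_l1_average\<close> controls it.\<close>

lemma wt_smoothing:
  fixes g :: "int \<Rightarrow> complex"
  assumes "finite S" "R \<subseteq> S" "K \<ge> 0" "P \<ge> 1" "K * P\<^sup>2 \<le> K'" "loss K R \<le> H" "loss K' S \<le> H"
    and "periodic g" "\<And>t. norm (g t) \<le> 1"
  shows "norm ((\<Sum>s\<in>{0..<N}. of_real (wt K R s) * g s) -
      (\<Sum>s\<in>{0..<N}. of_real (wt K R s) * ((\<Sum>t\<in>{0..<N}. of_real (wt K' S t) * g (s + t)) / of_real (mass K' S))))
    \<le> 6 * H / P * mass K R" (is "norm (?A - ?B) \<le> _")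
proof -
  let ?V = "mass K' S"
  have V: "?V > 0" by (rule mass_pos)
  have A: "of_real ?V * ?A = (\<Sum>t\<in>{0..<N}. of_real (wt K' S t) * (\<Sum>s\<in>{0..<N}. of_real (wt K R (s + t)) * g (s + t)))"
  proof -
    have "periodic (\<lambda>s. of_real (wt K R s) * g s)"
      using assms(8) periodic_wt by (simp add: periodic_def)
    from sum_shift[OF this] show ?thesis by (simp add: mass_def sum_distrib_right)
  qed
  have B: "of_real ?V * ?B = (\<Sum>t\<in>{0..<N}. of_real (wt K' S t) * (\<Sum>s\<in>{0..<N}. of_real (wt K R s) * g (s + t)))"
  proof -
    have "of_real ?V * ?B = (\<Sum>s\<in>{0..<N}. \<Sum>t\<in>{0..<N}. of_real (wt K' S t) * (of_real (wt K R s) * g (s + t)))"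
      using V by (simp add: sum_distrib_left sum_divide_distrib mult_ac)
    also have "\<dots> = (\<Sum>t\<in>{0..<N}. of_real (wt K' S t) * (\<Sum>s\<in>{0..<N}. of_real (wt K R s) * g (s + t)))"
      by (subst sum.swap) (simp add: sum_distrib_left)
    finally show ?thesis .
  qed
  have "?V * norm (?A - ?B) = norm (of_real ?V * ?A - of_real ?V * ?B)"
    using V by (simp add: norm_mult flip: right_diff_distrib)
  also have "\<dots> = norm (\<Sum>t\<in>{0..<N}. of_real (wt K' S t) *
      (\<Sum>s\<in>{0..<N}. of_real (wt K R (s + t) - wt K R s) * g (s + t)))"
    unfolding A B by (simp add: left_diff_distrib right_diff_distrib sum_subtractf)
  also have "\<dots> \<le> (\<Sum>t\<in>{0..<N}. wt K' S t * (\<Sum>s\<in>{0..<N}. \<bar>wt K R (s + t) - wt K R s\<bar>))"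
  proof (intro sum_norm_le)
    fix t
    have "norm (\<Sum>s\<in>{0..<N}. of_real (wt K R (s + t) - wt K R s) * g (s + t))
        \<le> (\<Sum>s\<in>{0..<N}. \<bar>wt K R (s + t) - wt K R s\<bar>)"
    proof (intro sum_norm_le)
      fix s
      show "norm (of_real (wt K R (s + t) - wt K R s) * g (s + t)) \<le> \<bar>wt K R (s + t) - wt K R s\<bar>"
        using assms(9)[of "s + t"] unfolding norm_mult norm_of_real
        by (metis abs_ge_zero mult_left_le)
    qed
    then show "norm (of_real (wt K' S t) * (\<Sum>s\<in>{0..<N}. of_real (wt K R (s + t) - wt K R s) * g (s + t)))
        \<le> wt K' S t * (\<Sum>s\<in>{0..<N}. \<bar>wt K R (s + t) - wt K R s\<bar>)"
      unfolding norm_mult norm_of_real by (simp add: wt_nonneg mult_left_mono)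
  qed
  also have "\<dots> \<le> 6 * H / P * (mass K R * ?V)"
    using assms by (intro wt_shift_l1_average)
  also have "\<dots> = ?V * (6 * H / P * mass K R)" by simp
  finally show ?thesis using V by (simp only: mult_le_cancel_left_pos)
qed

text \<open>All Fourier coefficients of the weight are non-negative, so dropping every term but the
  one at frequency 0 gives a lower bound.\<close>

lemma sum_differences_wt_ge:
  assumes "finite R" "K \<ge> 0"
  shows "mass K R * (real (card B))\<^sup>2 \<le> of_int N * (\<Sum>b\<in>B. \<Sum>b'\<in>B. wt K R (b - b'))"
proof -
  let ?w = "\<lambda>t. complex_of_real (wt K R t)"
  have per: "periodic ?w" using periodic_wt by (simp add: periodic_def)
  have Re: "Re (ft ?w r) \<ge> 0" for r
  proof -
    \<comment> \<open>Up to the positive factor \<open>exp (- K * card R)\<close>, the weight is the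
      exponential of a non-negative combination of cosines.\<close>
    define g where "g t = K * (\<Sum>r\<in>R. Re (chr r t))" for t
    have "posdef (\<lambda>t. of_real K * (\<Sum>r\<in>R. of_real (Re (chr r t))))"
      using assms by (intro posdef.scale posdef_sum posdef_Re_chr)
    then have "posdef (\<lambda>t. of_real (g t))" by (simp add: g_def)
    then have nn: "Re (ft (\<lambda>t. of_real (exp (g t))) r) \<ge> 0" by (rule ft_exp_posdef)
    have "wt K R t = exp (- K * real (card R)) * exp (g t)" for t
      by (simp add: wt_def dev_def g_def sum_subtractf algebra_simps flip: exp_add)
    then have "ft ?w r = of_real (exp (- K * real (card R))) * ft (\<lambda>t. of_real (exp (g t))) r"
      by (simp add: ft_def sum_distrib_left mult_ac)
    then show ?thesis using nn by simp
  qed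
  have "ft ?w 0 = of_real (mass K R)" by (simp add: ft_def mass_def)
  then have "mass K R * (real (card B))\<^sup>2 = Re (ft ?w 0) * (norm (\<Sum>b\<in>B. chr 0 b))\<^sup>2"
    by simp
  also have "\<dots> \<le> (\<Sum>r\<in>{0..<N}. Re (ft ?w r) * (norm (\<Sum>b\<in>B. chr r b))\<^sup>2)"
    using N_pos Re by (intro member_le_sum) auto
  also have "\<dots> = Re (\<Sum>r\<in>{0..<N}. ft ?w r * of_real ((norm (\<Sum>b\<in>B. chr r b))\<^sup>2))"
    by (simp add: Re_sum del: of_real_power)
  also have "\<dots> = of_int N * (\<Sum>b\<in>B. \<Sum>b'\<in>B. wt K R (b - b'))"
    by (simp only: sum_differences_ft[OF per, symmetric]) (simp flip: of_real_sum)
  finally show ?thesis .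
qed

end

subsection \<open>The density increment\<close>

text \<open>\<open>X\<close> and the \<open>B x\<close> represent subsets of the cyclic group of order \<open>N\<close>, as an \<open>N\<close>-periodic set
  and as sets of residues respectively.\<close>

locale sparse_columns = cyclic_sums +
  fixes X :: "int set" and B :: "int \<Rightarrow> int set" and \<beta> :: real
  assumes X_periodic: "t + N \<in> X \<longleftrightarrow> t \<in> X"
    and beta_pos: "\<beta> > 0"
    and X_dense: "\<beta> * of_int N \<le> real (card (X \<inter> {0..<N}))"
    and B_sub: "x \<in> X \<Longrightarrow> B x \<subseteq> {0..<N}"
    and B_dense: "x \<in> X \<Longrightarrow> \<beta> * of_int N \<le> real (card (B x))"
    and free: "x \<in> X \<Longrightarrow> b \<in> B x \<Longrightarrow> b' \<in> B x \<Longrightarrow> x + (b - b') \<in> X \<Longrightarrow> b = b'"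
begin

lemma beta_le_1: "\<beta> \<le> 1"
proof -
  have "card (X \<inter> {0..<N}) \<le> card {0..<N}" by (intro card_mono) auto
  then have "real (card (X \<inter> {0..<N})) \<le> of_int N"
    using N_pos by (simp flip: of_nat_le_iff[where 'a = real])
  then have "\<beta> * of_int N \<le> 1 * real_of_int N" using X_dense by simp
  then show ?thesis using N_pos by simp
qed

definition dens :: "real \<Rightarrow> int set \<Rightarrow> int \<Rightarrow> real" where
  "dens K R a = (\<Sum>t\<in>{0..<N}. wt K R t * of_bool (a + t \<in> X)) / mass K R"

lemma dens_nonneg: "dens K R a \<ge> 0"
  unfolding dens_def using mass_pos[of K R]
  by (intro divide_nonneg_pos sum_nonneg) (auto simp: wt_nonneg)

lemma dens_le_1: "dens K R a \<le> 1"
proof -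
  have "(\<Sum>t\<in>{0..<N}. wt K R t * of_bool (a + t \<in> X)) \<le> mass K R"
    unfolding mass_def by (intro sum_mono) (auto simp: wt_nonneg)
  then show ?thesis unfolding dens_def using mass_pos[of K R] by simp
qed

lemma mass_dens: "mass K R * dens K R a = (\<Sum>t\<in>{0..<N}. wt K R t * of_bool (a + t \<in> X))"
  unfolding dens_def using mass_pos[of K R] by simp

lemma periodic_X: "periodic (\<lambda>s. f (a + s \<in> X))"
  using X_periodic by (simp add: periodic_def flip: add.assoc)

text \<open>Only the pairs \<open>b = b'\<close> contribute to the sum of \<open>w (b - b') 1\<^sub>X (x + b - b')\<close>, whereas positive
  definiteness of \<open>w\<close> makes the sum of \<open>w (b - b')\<close> at least its expected size. Hence the balanced
  function \<open>w (1\<^sub>X (x + \<cdot>) - \<delta>)\<close> correlates with the autocorrelation of \<open>B x\<close>, whose Fourier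
  coefficients are non-negative with a controlled sum.\<close>

lemma large_coefficient:
  assumes "finite R" "K \<ge> 0" "x \<in> X"
  shows "\<exists>r. dens K R x * \<beta> * mass K R - 1
    \<le> norm (\<Sum>s\<in>{0..<N}. of_real (wt K R s) * (of_real (of_bool (x + s \<in> X) - dens K R x) * chr r s))"
proof -
  define d where "d = dens K R x"
  define F where "F s = complex_of_real (wt K R s * (of_bool (x + s \<in> X) - d))" for s
  let ?Q = "\<Sum>b\<in>B x. \<Sum>b'\<in>B x. wt K R (b - b')"
  have fin: "finite (B x)" using B_sub[OF assms(3)] finite_subset by blast
  have card_pos: "real (card (B x)) > 0"
    using B_dense[OF assms(3)] beta_pos N_pos by (smt (verit) mult_pos_pos of_int_pos)
  have "periodic F"
    using periodic_wt periodic_X[of id x] by (simp add: periodic_def F_def)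
  then obtain r where r: "norm (\<Sum>b\<in>B x. \<Sum>b'\<in>B x. F (b - b')) \<le> norm (ft F r) * real (card (B x))"
    using large_ft_exists[OF _ B_sub[OF assms(3)]] by blast
  have "(\<Sum>b\<in>B x. \<Sum>b'\<in>B x. F (b - b')) =
      of_real ((\<Sum>b\<in>B x. \<Sum>b'\<in>B x. wt K R (b - b') * of_bool (x + (b - b') \<in> X)) - d * ?Q)"
    by (simp add: F_def algebra_simps sum_subtractf sum_distrib_left)
  \<comment> \<open>By \<open>free\<close> only the diagonal survives, where the weight is 1 and
    \<open>x\<close> itself lies in \<open>X\<close>.\<close>
  also have "(\<Sum>b\<in>B x. \<Sum>b'\<in>B x. wt K R (b - b') * of_bool (x + (b - b') \<in> X)) =
      (\<Sum>b\<in>B x. \<Sum>b'\<in>B x. if b' = b then 1 else 0)"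
    using free[OF assms(3)] assms(3) by (intro sum.cong refl) auto
  also have "\<dots> = real (card (B x))" using fin by simp
  finally have eq: "norm (\<Sum>b\<in>B x. \<Sum>b'\<in>B x. F (b - b')) = \<bar>real (card (B x)) - d * ?Q\<bar>"
    by (simp only: norm_of_real)
  have "d * (\<beta> * mass K R * real (card (B x))) \<le> d * ?Q"
  proof (intro mult_left_mono)
    have "\<beta> * mass K R * real (card (B x)) * of_int N = (\<beta> * of_int N) * (mass K R * real (card (B x)))"
      by simp
    also have "\<dots> \<le> real (card (B x)) * (mass K R * real (card (B x)))"
      using B_dense[OF assms(3)] mass_pos[of K R] by (intro mult_right_mono) auto
    also have "\<dots> \<le> ?Q * of_int N"
      using sum_differences_wt_ge[OF assms(1,2), of "B x"] by (simp add: power2_eq_square mult_ac)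
    finally show "\<beta> * mass K R * real (card (B x)) \<le> ?Q" using N_pos by simp
  qed (simp add: d_def dens_nonneg)
  \<comment> \<open>The diagonal contributes \<open>card (B x)\<close>, which becomes the subtracted
    1 after division by \<open>card (B x)\<close>.\<close>
  with r eq have "(d * \<beta> * mass K R - 1) * real (card (B x)) \<le> norm (ft F r) * real (card (B x))"
    by (simp add: algebra_simps)
  then have "d * \<beta> * mass K R - 1 \<le> norm (ft F r)" using card_pos by simp
  moreover have "ft F r = (\<Sum>s\<in>{0..<N}. of_real (wt K R s) * (of_real (of_bool (x + s \<in> X) - d) * chr r s))"
    by (simp add: ft_def F_def mult.assoc)
  ultimately show ?thesis unfolding d_def by (intro exI[of _ r]) simp
qed

text \<open>The finer densities nearly average to the coarse one. A uniform upper bound on them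
  therefore also limits how far they can drop on average.\<close>

lemma dens_smoothing:
  assumes "finite S" "R \<subseteq> S" "K \<ge> 0" "P \<ge> 1" "K * P\<^sup>2 \<le> K'" "loss K R \<le> H" "loss K' S \<le> H"
  shows "\<bar>mass K R * dens K R a - (\<Sum>s\<in>{0..<N}. wt K R s * dens K' S (a + s))\<bar> \<le> 6 * H / P * mass K R"
proof -
  let ?g = "\<lambda>s. complex_of_real (of_bool (a + s \<in> X))"
  have "norm ((\<Sum>s\<in>{0..<N}. of_real (wt K R s) * ?g s) -
      (\<Sum>s\<in>{0..<N}. of_real (wt K R s) * ((\<Sum>t\<in>{0..<N}. of_real (wt K' S t) * ?g (s + t)) / of_real (mass K' S))))
    \<le> 6 * H / P * mass K R"
    by (rule wt_smoothing[OF assms periodic_X]) simp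
  moreover have "(\<Sum>s\<in>{0..<N}. of_real (wt K R s) * ?g s) -
      (\<Sum>s\<in>{0..<N}. of_real (wt K R s) * ((\<Sum>t\<in>{0..<N}. of_real (wt K' S t) * ?g (s + t)) / of_real (mass K' S)))
    = of_real (mass K R * dens K R a - (\<Sum>s\<in>{0..<N}. wt K R s * dens K' S (a + s)))"
    by (simp only: mass_dens) (simp add: dens_def add.assoc del: sum_mult_of_bool_eq sum_of_bool_mult_eq)
  ultimately show ?thesis by (simp only: norm_of_real)
qed

text \<open>On fine translates \<open>chr r\<close> is nearly constant, so a large coefficient
  forces the finer densities \<open>D s\<close> to deviate from \<open>d\<close> on average. Their
  mean is nearly \<open>d\<close>, so some of them must exceed it. The loss
  \<open>14 * H / P\<close> collects 6 for smoothing \<open>g\<close>, 2 for the variation of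
  \<open>chr r\<close> and 6 for the mean of \<open>D\<close>.\<close>

lemma spectral_increment:
  assumes "finite R" "K \<ge> 0" "P \<ge> 1" "K * P\<^sup>2 \<le> K'" "P\<^sup>2 \<le> K'" "H \<ge> 1"
    and "loss K R \<le> H" "loss K' (insert r R) \<le> H"
    and coeff: "\<eta> * mass K R \<le> norm (\<Sum>s\<in>{0..<N}.
      of_real (wt K R s) * (of_real (of_bool (x + s \<in> X) - dens K R x) * chr r s))"
    and eta: "\<eta> > 14 * H / P"
  shows "\<exists>a. dens K' (insert r R) a \<ge> dens K R x + (\<eta> - 14 * H / P) / 2"
proof (rule ccontr)
  define S where "S = insert r R"
  define d where "d = dens K R x"
  define D where "D s = dens K' S (x + s)" for s
  define \<gamma> where "\<gamma> = (\<eta> - 14 * H / P) / 2"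
  let ?W = "mass K R" and ?V = "mass K' S"
  assume "\<not> ?thesis"
  then have small: "D s < d + \<gamma>" for s
    by (auto simp: D_def d_def S_def \<gamma>_def not_le)
  have "\<gamma> > 0" using eta by (simp add: \<gamma>_def)
  have "P > 0" using assms(3) by simp
  have W: "?W > 0" and V: "?V > 0" by (rule mass_pos)+
  have d01: "0 \<le> d" "d \<le> 1" by (simp_all add: d_def dens_nonneg dens_le_1)
  define e where "e = (\<Sum>t\<in>{0..<N}. wt K' S t * norm (chr r t - 1))"
  have e: "e \<le> 2 * H / P * ?V"
  proof -
    have "norm (chr r t - 1) \<le> 1 / (2 * P) + P * dev S t" for t
    proof -
      have "(norm (chr r t - 1))\<^sup>2 = 2 * (1 - Re (chr r t))"
      proof -
        have "(Re (chr r t))\<^sup>2 + (Im (chr r t))\<^sup>2 = 1"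
          using norm_chr[of r t] by (metis cmod_power2 power_one)
        then show ?thesis unfolding cmod_power2 by (simp add: power2_eq_square algebra_simps)
      qed
      \<comment> \<open>This is why \<open>r\<close> is added to the frequency set: the fine weight
        then controls the variation of \<open>chr r\<close>.\<close>
      also have "1 - Re (chr r t) \<le> dev S t"
        using dev_mono[of S "{r}" t] assms(1) by (simp add: S_def dev_def)
      finally have sq: "(norm (chr r t - 1))\<^sup>2 \<le> 2 * dev S t" by simp
      have "norm (chr r t - 1) \<le> (1 / P * 1\<^sup>2 + (norm (chr r t - 1))\<^sup>2 / (1 / P)) / 2"
        using abs_mult_le_weighted[of "1 / P" 1 "norm (chr r t - 1)"] \<open>P > 0\<close> by simp
      also have "\<dots> \<le> (1 / P * 1\<^sup>2 + 2 * dev S t / (1 / P)) / 2"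
        using sq \<open>P > 0\<close> by (intro divide_right_mono add_left_mono) auto
      finally show ?thesis by (simp add: field_simps)
    qed
    then have "e \<le> (\<Sum>t\<in>{0..<N}. wt K' S t * (1 / (2 * P) + P * dev S t))"
      unfolding e_def by (intro sum_mono mult_left_mono wt_nonneg)
    also have "\<dots> = ?V / (2 * P) + P * (\<Sum>t\<in>{0..<N}. wt K' S t * dev S t)"
      by (simp add: distrib_left sum.distrib mass_def sum_divide_distrib sum_distrib_left mult_ac)
    also have "P * (\<Sum>t\<in>{0..<N}. wt K' S t * dev S t) \<le> ?V * H / P"
    proof -
      have "P\<^sup>2 * (\<Sum>t\<in>{0..<N}. wt K' S t * dev S t) \<le> K' * (\<Sum>t\<in>{0..<N}. wt K' S t * dev S t)"
        using assms(5) by (intro mult_right_mono sum_nonneg) (auto simp: wt_nonneg dev_nonneg)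
      also have "\<dots> \<le> ?V * loss K' S" by (rule mean_dev_le_loss)
      also have "\<dots> \<le> ?V * H" using V assms(8) by (simp add: S_def)
      finally show ?thesis using \<open>P > 0\<close> by (simp add: field_simps power2_eq_square)
    qed
    also have "?V / (2 * P) + ?V * H / P \<le> 2 * H / P * ?V"
    proof -
      have "?V \<le> ?V * H" using V assms(6) by simp
      moreover have "?V * H \<ge> 0" using V assms(6) by simp
      ultimately show ?thesis using \<open>P > 0\<close> by (simp add: field_simps)
    qed
    finally show ?thesis by simp
  qed
  define g where "g s = complex_of_real (of_bool (x + s \<in> X) - d) * chr r s" for s
  have g1: "norm (g s) \<le> 1" for s
    using d01 by (simp add: g_def norm_mult of_bool_def del: of_real_diff)
  have gper: "periodic g"
    using periodic_X[of id x] periodic_chr[of r] by (simp add: periodic_def g_def)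
  let ?M = "\<Sum>s\<in>{0..<N}. of_real (wt K R s) *
    ((\<Sum>t\<in>{0..<N}. of_real (wt K' S t) * g (s + t)) / of_real ?V)"
  have "norm ((\<Sum>s\<in>{0..<N}. of_real (wt K R s) * g s) - ?M) \<le> 6 * H / P * ?W"
    using assms g1 gper by (intro wt_smoothing) (auto simp: S_def)
  moreover have "\<eta> * ?W \<le> norm (\<Sum>s\<in>{0..<N}. of_real (wt K R s) * g s)"
    using coeff by (simp add: g_def d_def)
  ultimately have M1: "\<eta> * ?W - 6 * H / P * ?W \<le> norm ?M"
    using norm_triangle_ineq2[of "\<Sum>s\<in>{0..<N}. of_real (wt K R s) * g s" ?M] by linarith
  have M2: "norm ?M \<le> (\<Sum>s\<in>{0..<N}. wt K R s * (\<bar>D s - d\<bar> + 2 * H / P))"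
  proof (intro sum_norm_le)
    fix s
    have "(\<Sum>t\<in>{0..<N}. of_real (wt K' S t) * g (s + t)) =
        chr r s * of_real (\<Sum>t\<in>{0..<N}. wt K' S t * (of_bool (x + s + t \<in> X) - d)) +
        (\<Sum>t\<in>{0..<N}. of_real (wt K' S t) * (of_real (of_bool (x + s + t \<in> X) - d) * (chr r s * (chr r t - 1))))"
      by (simp add: g_def chr_add sum_distrib_left algebra_simps flip: sum.distrib)
    also have "(\<Sum>t\<in>{0..<N}. wt K' S t * (of_bool (x + s + t \<in> X) - d)) = ?V * (D s - d)"
    proof -
      have "(\<Sum>t\<in>{0..<N}. wt K' S t * (of_bool (x + s + t \<in> X) - d)) =
          (\<Sum>t\<in>{0..<N}. wt K' S t * of_bool (x + s + t \<in> X)) - ?V * d"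
        by (simp only: right_diff_distrib sum_subtractf mass_def sum_distrib_right)
      then show ?thesis by (simp only: D_def right_diff_distrib mass_dens)
    qed
    finally have split: "(\<Sum>t\<in>{0..<N}. of_real (wt K' S t) * g (s + t)) =
        chr r s * of_real (?V * (D s - d)) +
        (\<Sum>t\<in>{0..<N}. of_real (wt K' S t) * (of_real (of_bool (x + s + t \<in> X) - d) * (chr r s * (chr r t - 1))))" .
    have "norm (\<Sum>t\<in>{0..<N}. of_real (wt K' S t) * (of_real (of_bool (x + s + t \<in> X) - d) * (chr r s * (chr r t - 1)))) \<le> e"
      unfolding e_def
    proof (intro sum_norm_le)
      fix t
      have "\<bar>of_bool (x + s + t \<in> X) - d\<bar> * norm (chr r t - 1) \<le> norm (chr r t - 1)"
        using d01 by (intro mult_left_le_one_le) (auto simp: of_bool_def)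
      then show "norm (of_real (wt K' S t) * (of_real (of_bool (x + s + t \<in> X) - d) * (chr r s * (chr r t - 1))))
          \<le> wt K' S t * norm (chr r t - 1)"
        unfolding norm_mult norm_of_real norm_chr by (simp add: wt_nonneg mult_left_mono)
    qed
    with split have "norm (\<Sum>t\<in>{0..<N}. of_real (wt K' S t) * g (s + t)) \<le>
        norm (chr r s * of_real (?V * (D s - d))) + e"
      by (simp only:) (intro norm_triangle_le add_left_mono)
    also have "norm (chr r s * of_real (?V * (D s - d))) = ?V * \<bar>D s - d\<bar>"
      unfolding norm_mult norm_chr norm_of_real using V by (simp add: abs_mult)
    also have "?V * \<bar>D s - d\<bar> + e \<le> (\<bar>D s - d\<bar> + 2 * H / P) * ?V"
      using e by (simp add: algebra_simps)
    finally have "norm ((\<Sum>t\<in>{0..<N}. of_real (wt K' S t) * g (s + t)) / of_real ?V) \<le> \<bar>D s - d\<bar> + 2 * H / P"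
      using V by (simp add: norm_divide divide_le_eq)
    then show "norm (of_real (wt K R s) * ((\<Sum>t\<in>{0..<N}. of_real (wt K' S t) * g (s + t)) / of_real ?V))
        \<le> wt K R s * (\<bar>D s - d\<bar> + 2 * H / P)"
      unfolding norm_mult norm_of_real by (simp add: wt_nonneg mult_left_mono)
  qed
  \<comment> \<open>An upper bound on \<open>D s\<close> alone controls the absolute value: above
    \<open>d\<close> the excess is below \<open>\<gamma>\<close>, and below \<open>d\<close> the
    term \<open>d - D s\<close> is already present. That term nearly cancels on average.\<close>
  have M3: "(\<Sum>s\<in>{0..<N}. wt K R s * (\<bar>D s - d\<bar> + 2 * H / P))
      < (\<Sum>s\<in>{0..<N}. wt K R s * (2 * \<gamma> + d - D s + 2 * H / P))"
  proof (intro sum_strict_mono mult_strict_left_mono wt_pos)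
    fix s show "\<bar>D s - d\<bar> + 2 * H / P < 2 * \<gamma> + d - D s + 2 * H / P"
      using small[of s] \<open>\<gamma> > 0\<close> by linarith
  qed (use N_pos in auto)
  have M4: "(\<Sum>s\<in>{0..<N}. wt K R s * (2 * \<gamma> + d - D s + 2 * H / P)) =
      ?W * (2 * \<gamma> + 2 * H / P) + (?W * d - (\<Sum>s\<in>{0..<N}. wt K R s * D s))"
  proof -
    have "(\<Sum>s\<in>{0..<N}. wt K R s * (2 * \<gamma> + d - D s + 2 * H / P)) =
      (\<Sum>s\<in>{0..<N}. wt K R s * (2 * \<gamma> + 2 * H / P) + wt K R s * d - wt K R s * D s)"
      by (intro sum.cong refl) (simp add: algebra_simps)
    then show ?thesis by (simp only: sum.distrib sum_subtractf mass_def sum_distrib_right)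
  qed
  have "\<bar>?W * d - (\<Sum>s\<in>{0..<N}. wt K R s * D s)\<bar> \<le> 6 * H / P * ?W"
    unfolding d_def D_def using assms by (intro dens_smoothing) (auto simp: S_def)
  with M1 M2 M3 M4 have "\<eta> * ?W - 6 * H / P * ?W < ?W * (2 * \<gamma> + 2 * H / P) + 6 * H / P * ?W"
    by linarith
  also have "\<dots> = \<eta> * ?W - 6 * H / P * ?W"
    by (simp add: \<gamma>_def field_simps)
  finally show False by simp
qed

text \<open>The first alternative is needed to recentre: if no translate of the finer weight already gives an
  increment, then almost every translate has density close to that of \<open>a\<close>, in particular one
  centred at a point of \<open>X\<close>.\<close>

lemma density_increment:
  assumes "finite R" "K \<ge> 1" "P \<ge> 1" "H \<ge> 1"
    and loss: "loss K R \<le> H" "loss (K * P\<^sup>2) R \<le> H" "\<And>r. loss (K * P\<^sup>2 * P\<^sup>2) (insert r R) \<le> H"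
    and P: "6 * H / P \<le> \<beta> ^ 3 / 100"
    and big: "mass (K * P\<^sup>2) R \<ge> 4 / \<beta>\<^sup>2"
    and a: "dens K R a \<ge> \<beta>"
  shows "(\<exists>a'. dens (K * P\<^sup>2) R a' \<ge> dens K R a + \<beta> ^ 3 / 100) \<or>
    (\<exists>r a'. dens (K * P\<^sup>2 * P\<^sup>2) (insert r R) a' \<ge> dens K R a + \<beta> ^ 3 / 100)"
proof (rule disjCI)
  define \<kappa> where "\<kappa> = \<beta> ^ 3 / 100"
  define d where "d = dens K R a"
  let ?K = "K * P\<^sup>2"
  assume "\<not> (\<exists>r a'. dens (K * P\<^sup>2 * P\<^sup>2) (insert r R) a' \<ge> dens K R a + \<beta> ^ 3 / 100)"
  then have no: "dens (?K * P\<^sup>2) (insert r R) a' < d + \<kappa>" for r a'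
    by (auto simp: d_def \<kappa>_def not_le)
  have b: "0 < \<beta>" "\<beta> \<le> 1" by (fact beta_pos beta_le_1)+
  have P2: "P\<^sup>2 \<ge> 1" using assms(3) by simp
  have K1: "?K \<ge> 1" using assms(2) P2 by (metis mult_mono mult_1 zero_le_one order_trans)
  have "\<beta>\<^sup>2 > 0" using b by simp
  have \<kappa>b: "\<kappa> \<le> \<beta>\<^sup>2 / 100" "\<kappa> > 0"
    using b by (auto simp: \<kappa>_def power3_eq_cube power2_eq_square mult_left_le)
  have "\<beta>\<^sup>2 \<le> \<beta>" using b by (simp add: power2_eq_square mult_left_le)
  show "\<exists>a'. dens ?K R a' \<ge> dens K R a + \<beta> ^ 3 / 100"
  proof (rule ccontr)
    assume "\<not> ?thesis"
    then have no1: "dens ?K R a' < d + \<kappa>" for a'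
      by (auto simp: d_def \<kappa>_def not_le)
    \<comment> \<open>\<open>X\<close> has relative weight \<open>d\<close> around \<open>a\<close>.
      If all its points had low density, the average of the finer densities would be at most
      \<open>d + \<kappa> - \<beta>^2 / 25 * d\<close>, but it is at least
      \<open>d - \<kappa>\<close>. This fails because \<open>d \<ge> \<beta>\<close> and
      \<open>\<beta>^3 / 25 = 4 * \<kappa>\<close>.\<close>
    have "\<exists>x\<in>X. dens ?K R x \<ge> d - \<beta>\<^sup>2 / 25"
    proof (rule ccontr)
      assume "\<not> ?thesis"
      then have low: "dens ?K R x < d - \<beta>\<^sup>2 / 25" if "x \<in> X" for x
        using that by (auto simp: not_le)
      let ?W = "mass K R"
      have W: "?W > 0" by (rule mass_pos)
      have "(\<Sum>s\<in>{0..<N}. wt K R s * dens ?K R (a + s))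
          \<le> (\<Sum>s\<in>{0..<N}. wt K R s * ((d + \<kappa>) - (\<beta>\<^sup>2 / 25) * of_bool (a + s \<in> X)))"
      proof (intro sum_mono mult_left_mono wt_nonneg)
        fix s
        show "dens ?K R (a + s) \<le> (d + \<kappa>) - (\<beta>\<^sup>2 / 25) * of_bool (a + s \<in> X)"
          using low[of "a + s"] no1[of "a + s"] \<kappa>b by (cases "a + s \<in> X") auto
      qed
      also have "\<dots> = ?W * (d + \<kappa>) - \<beta>\<^sup>2 / 25 * (?W * d)"
      proof -
        have "(\<Sum>s\<in>{0..<N}. wt K R s * ((d + \<kappa>) - (\<beta>\<^sup>2 / 25) * of_bool (a + s \<in> X))) =
          (\<Sum>s\<in>{0..<N}. wt K R s * (d + \<kappa>) - (\<beta>\<^sup>2 / 25) * (wt K R s * of_bool (a + s \<in> X)))"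
          by (intro sum.cong refl) (simp add: algebra_simps)
        also have "\<dots> = ?W * (d + \<kappa>) - \<beta>\<^sup>2 / 25 * (\<Sum>s\<in>{0..<N}. wt K R s * of_bool (a + s \<in> X))"
          by (simp only: sum_subtractf mass_def sum_distrib_right sum_distrib_left)
        finally show ?thesis by (simp only: d_def mass_dens)
      qed
      finally have up: "(\<Sum>s\<in>{0..<N}. wt K R s * dens ?K R (a + s)) \<le> ?W * (d + \<kappa>) - \<beta>\<^sup>2 / 25 * (?W * d)" .
      have "\<bar>?W * d - (\<Sum>s\<in>{0..<N}. wt K R s * dens ?K R (a + s))\<bar> \<le> 6 * H / P * ?W"
        unfolding d_def using assms by (intro dens_smoothing) auto
      also have "\<dots> \<le> \<kappa> * ?W" using P W unfolding \<kappa>_def by (intro mult_right_mono) auto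
      finally have "?W * d - \<kappa> * ?W \<le> ?W * (d + \<kappa>) - \<beta>\<^sup>2 / 25 * (?W * d)" using up by linarith
      then have "?W * (\<beta>\<^sup>2 / 25 * d) \<le> ?W * (2 * \<kappa>)" by (simp add: algebra_simps)
      then have "\<beta>\<^sup>2 / 25 * d \<le> 2 * \<kappa>" using W by simp
      moreover have "\<beta>\<^sup>2 / 25 * \<beta> \<le> \<beta>\<^sup>2 / 25 * d"
        using a b by (intro mult_left_mono) (auto simp: d_def)
      moreover have "\<beta>\<^sup>2 / 25 * \<beta> = 4 * \<kappa>" by (simp add: \<kappa>_def power3_eq_cube power2_eq_square)
      ultimately show False using \<kappa>b by linarith
    qed
    then obtain x where x: "x \<in> X" "dens ?K R x \<ge> d - \<beta>\<^sup>2 / 25" by blast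
    define d' where "d' = dens ?K R x"
    obtain r where r: "d' * \<beta> * mass ?K R - 1
      \<le> norm (\<Sum>s\<in>{0..<N}. of_real (wt ?K R s) * (of_real (of_bool (x + s \<in> X) - d') * chr r s))"
      using large_coefficient[OF assms(1) _ x(1), of ?K] K1 by (auto simp: d'_def)
    have d': "d' \<ge> \<beta> / 2" using x(2) a \<open>\<beta>\<^sup>2 \<le> \<beta>\<close> b by (simp add: d'_def d_def)
    \<comment> \<open>The mass is so large that the diagonal term 1 costs at most half of the main
      term, which is at least \<open>\<beta>^2 / 2\<close> times the mass.\<close>
    have "\<beta>\<^sup>2 / 4 * mass ?K R \<le> d' * \<beta> * mass ?K R - 1"
    proof -
      have "1 \<le> \<beta>\<^sup>2 / 4 * mass ?K R" using big \<open>\<beta>\<^sup>2 > 0\<close> by (simp add: field_simps)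
      moreover have "\<beta> / 2 * \<beta> * mass ?K R \<le> d' * \<beta> * mass ?K R"
        using d' b mass_pos[of ?K R] by (intro mult_right_mono) auto
      ultimately show ?thesis by (simp add: power2_eq_square)
    qed
    with r have coeff: "\<beta>\<^sup>2 / 4 * mass ?K R
      \<le> norm (\<Sum>s\<in>{0..<N}. of_real (wt ?K R s) * (of_real (of_bool (x + s \<in> X) - dens ?K R x) * chr r s))"
      by (simp add: d'_def)
    define q where "q = 14 * H / P"
    have HP: "q \<le> 14 / 600 * \<beta>\<^sup>2" using P \<kappa>b by (simp add: \<kappa>_def q_def)
    have "\<exists>a. dens (?K * P\<^sup>2) (insert r R) a \<ge> dens ?K R x + (\<beta>\<^sup>2 / 4 - q) / 2"
      unfolding q_def
    proof (rule spectral_increment[OF assms(1) _ assms(3) _ _ assms(4) loss(2) loss(3) coeff])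
      show "P\<^sup>2 \<le> ?K * P\<^sup>2" using K1 P2 by (metis mult_1 mult_right_mono zero_le_power2)
      show "14 * H / P < \<beta>\<^sup>2 / 4" using HP \<open>\<beta>\<^sup>2 > 0\<close> unfolding q_def by linarith
    qed (use K1 in auto)
    then obtain a' where "dens (?K * P\<^sup>2) (insert r R) a' \<ge> dens ?K R x + (\<beta>\<^sup>2 / 4 - q) / 2"
      by blast
    \<comment> \<open>With \<open>c\<close> for \<open>\<beta>^2\<close>, the gain
      \<open>(c / 4 - p) / 2\<close> exceeds \<open>11 * c / 100\<close>, more than the
      \<open>c / 25\<close> given up by recentring and the increment \<open>k \<le> c / 100\<close>
      together.\<close>
    moreover have "False" if "v < e + k" "e - c / 25 \<le> u" "p \<le> 14 / 600 * c" "k \<le> c / 100" "0 < c"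
      "u + (c / 4 - p) / 2 \<le> v" for u v e k c p :: real
      using that by (simp add: field_simps)
    ultimately show False using no[of r a'] x(2) HP \<kappa>b \<open>\<beta>\<^sup>2 > 0\<close> by blast
  qed
qed

section \<open>Iteration and choice of parameters\<close>

text \<open>A step raises the exponent \<open>i\<close> by 1, or by 2 while adding a frequency; this
  explains \<open>i \<le> 2 * j\<close> and \<open>card R \<le> j\<close>. \<open>H\<close> bounds
  the loss of every weight that can occur within \<open>J\<close> steps.\<close>

lemma iterated_increment:
  fixes P J :: nat
  defines "H \<equiv> real J * (2 * real J * ln (real P) + 32)"
  assumes "P \<ge> 1" "J \<ge> 1"
    and P: "6 * H / real P \<le> \<beta> ^ 3 / 100"
    and big: "of_int N * exp (- H) \<ge> 4 / \<beta>\<^sup>2"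
  shows "j \<le> J \<Longrightarrow> \<exists>R i a. finite R \<and> card R \<le> j \<and> i \<le> 2 * j \<and>
    dens (((real P)\<^sup>2) ^ i) R a \<ge> \<beta> + real j * (\<beta> ^ 3 / 100)"
proof (induction j)
  case 0
  have "dens 1 {} 0 = real (card (X \<inter> {0..<N})) / of_int N"
  proof -
    have "{0..<N} \<inter> {t. t \<in> X} = X \<inter> {0..<N}" by auto
    then show ?thesis using N_pos by (simp add: dens_def mass_def wt_def dev_def)
  qed
  then have "dens 1 {} 0 \<ge> \<beta>" using X_dense N_pos by (simp add: pos_le_divide_eq)
  then show ?case by (intro exI[of _ "{}"] exI[of _ 0]) auto
next
  case (Suc j)
  then obtain R i a where R: "finite R" "card R \<le> j" "i \<le> 2 * j"
    and a: "dens (((real P)\<^sup>2) ^ i) R a \<ge> \<beta> + real j * (\<beta> ^ 3 / 100)"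
    by auto
  have loss: "loss (((real P)\<^sup>2) ^ i') S \<le> H" if "finite S" "card S \<le> J" "i' \<le> 2 * J" for i' S
  proof -
    \<comment> \<open>Here \<open>m = P ^ i'\<close>, the square root of the weight parameter, so
      that the quotient in \<open>loss_le\<close> equals 32.\<close>
    have "loss (((real P)\<^sup>2) ^ i') S \<le>
        real (card S) * (ln (real (P ^ i')) + 32 * ((real P)\<^sup>2) ^ i' / (real (P ^ i'))\<^sup>2)"
      using that(1) assms(2) by (intro loss_le) auto
    also have "\<dots> = real (card S) * (real i' * ln (real P) + 32)"
      using assms(2) by (simp add: ln_realpow power_mult[symmetric] mult.commute)
    also have "\<dots> \<le> real J * (2 * real J * ln (real P) + 32)"
      using that assms(2) by (intro mult_mono add_right_mono) auto
    finally show ?thesis by (simp add: H_def)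
  qed
  let ?K = "((real P)\<^sup>2) ^ i"
  have eqs: "?K * (real P)\<^sup>2 = ((real P)\<^sup>2) ^ (i + 1)" "((real P)\<^sup>2) ^ (i + 1) * (real P)\<^sup>2 = ((real P)\<^sup>2) ^ (i + 2)"
    by (simp_all add: algebra_simps power2_eq_square)
  have "(\<exists>a'. dens (?K * (real P)\<^sup>2) R a' \<ge> dens ?K R a + \<beta> ^ 3 / 100) \<or>
    (\<exists>r a'. dens (?K * (real P)\<^sup>2 * (real P)\<^sup>2) (insert r R) a' \<ge> dens ?K R a + \<beta> ^ 3 / 100)"
  proof (rule density_increment[OF R(1) _ _ _ _ _ _ P])
    show "1 \<le> ?K" "1 \<le> real P" using assms(2) by auto
    have "1 * 32 \<le> H"
      unfolding H_def using assms(2,3) by (intro mult_mono) auto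
    then show "1 \<le> H" by simp
    show "loss ?K R \<le> H" using R Suc.prems by (intro loss) auto
    show l2: "loss (?K * (real P)\<^sup>2) R \<le> H" unfolding eqs using R Suc.prems by (intro loss) auto
    show "loss (?K * (real P)\<^sup>2 * (real P)\<^sup>2) (insert r R) \<le> H" for r
      unfolding eqs using R Suc.prems
      by (intro loss) (auto simp: card_insert_if)
    have "of_int N * exp (- H) \<le> mass (?K * (real P)\<^sup>2) R"
      using l2 N_pos by (simp add: mass_eq_loss)
    then show "4 / \<beta>\<^sup>2 \<le> mass (?K * (real P)\<^sup>2) R" using big by linarith
    have "0 \<le> real j * (\<beta> ^ 3 / 100)" using beta_pos by simp
    then show "\<beta> \<le> dens ?K R a" using a by linarith
  qed
  then show ?case
  proof
    assume "\<exists>a'. dens (?K * (real P)\<^sup>2) R a' \<ge> dens ?K R a + \<beta> ^ 3 / 100"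
    then obtain a' where "dens (?K * (real P)\<^sup>2) R a' \<ge> dens ?K R a + \<beta> ^ 3 / 100" by blast
    then have "dens (((real P)\<^sup>2) ^ (i + 1)) R a' \<ge> \<beta> + real (Suc j) * (\<beta> ^ 3 / 100)"
      using a unfolding eqs of_nat_Suc distrib_right by linarith
    then show ?thesis using R by (intro exI[of _ R] exI[of _ "i + 1"] exI[of _ a']) auto
  next
    assume "\<exists>r a'. dens (?K * (real P)\<^sup>2 * (real P)\<^sup>2) (insert r R) a' \<ge> dens ?K R a + \<beta> ^ 3 / 100"
    then obtain r a' where "dens (?K * (real P)\<^sup>2 * (real P)\<^sup>2) (insert r R) a' \<ge> dens ?K R a + \<beta> ^ 3 / 100"
      by blast
    then have "dens (((real P)\<^sup>2) ^ (i + 2)) (insert r R) a' \<ge> \<beta> + real (Suc j) * (\<beta> ^ 3 / 100)"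
      using a unfolding eqs of_nat_Suc distrib_right by linarith
    then show ?thesis using R
      by (intro exI[of _ "insert r R"] exI[of _ "i + 2"] exI[of _ a']) (auto simp: card_insert_if)
  qed
qed

text \<open>After \<open>J\<close> increments the density would exceed 1, so the mass condition of
  the iteration must fail, and this failure bounds \<open>N\<close>. The condition on
  \<open>P\<close> also yields \<open>H \<le> P\<close>.\<close>

lemma group_order_bound:
  fixes P J :: nat
  assumes "P \<ge> 1" "J \<ge> 1" "real J * (\<beta> ^ 3 / 100) \<ge> 1"
    and P: "6 * (real J * (2 * real J * ln (real P) + 32)) / real P \<le> \<beta> ^ 3 / 100"
  shows "ln (of_int N) \<le> real P + 4 / \<beta>\<^sup>2"
proof -
  define H where "H = real J * (2 * real J * ln (real P) + 32)"
  have "H \<ge> 0" using assms(1) by (simp add: H_def)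
  have "of_int N * exp (- H) < 4 / \<beta>\<^sup>2"
  proof (rule ccontr)
    assume "\<not> ?thesis"
    then have "of_int N * exp (- (real J * (2 * real J * ln (real P) + 32))) \<ge> 4 / \<beta>\<^sup>2"
      by (simp add: H_def)
    from iterated_increment[OF assms(1,2) P this, of J]
    obtain K R a where "dens K R a \<ge> \<beta> + real J * (\<beta> ^ 3 / 100)" by auto
    then show False using assms(3) beta_pos dens_le_1[of K R a] by linarith
  qed
  then have "of_int N < 4 / \<beta>\<^sup>2 * exp H" by (simp add: exp_minus field_simps)
  then have "ln (of_int N) \<le> ln (4 / \<beta>\<^sup>2 * exp H)"
    using N_pos by (subst ln_le_cancel_iff) (auto intro: less_trans)
  also have "\<dots> = ln (4 / \<beta>\<^sup>2) + H" using beta_pos by (simp add: ln_mult ln_div)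
  also have "ln (4 / \<beta>\<^sup>2) \<le> 4 / \<beta>\<^sup>2" using beta_pos by (intro ln_bound) auto
  also have "H \<le> real P"
  proof -
    have "\<beta> ^ 3 \<le> 1" using beta_pos beta_le_1 by (simp add: power_le_one)
    then have "6 * H / real P \<le> 1" using P by (simp add: H_def)
    then show ?thesis using assms(1) \<open>H \<ge> 0\<close> by (simp add: field_simps)
  qed
  finally show ?thesis by simp
qed

text \<open>\<open>J\<close> is about \<open>100 / \<beta>^3\<close>, enough increments to pass
  density 1. Taking \<open>P = Q^2\<close> lets \<open>ln P \<le> 2 * Q\<close> absorb the
  logarithm: the loss bound is at most \<open>36 * J^2 * Q\<close>, so \<open>Q\<close> of order
  \<open>\<beta>^(-9)\<close> suffices and \<open>P\<close> yields the exponent 18.\<close>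

lemma ln_group_order_le:
  "ln (of_int N) \<le> (220341601\<^sup>2 + 4) / \<beta> ^ 18"
proof -
  have b: "0 < \<beta>" "\<beta> \<le> 1" by (fact beta_pos beta_le_1)+
  define J where "J = nat \<lceil>100 / \<beta> ^ 3\<rceil>"
  \<comment> \<open>\<open>220341600 = 21600 * 101\<^sup>2\<close>, where \<open>101 / \<beta> ^ 3\<close> bounds the number \<open>J\<close> of steps\<close>
  define Q where "Q = nat \<lceil>220341600 / \<beta> ^ 9\<rceil>"
  have p1: "1 \<le> 1 / \<beta> ^ k" for k using b by (simp add: power_le_one)
  have J1: "real J \<ge> 100 / \<beta> ^ 3" unfolding J_def by (rule real_nat_ceiling_ge)
  have J2: "real J \<le> 101 / \<beta> ^ 3"
  proof -
    have "real J \<le> 100 / \<beta> ^ 3 + 1"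
      using of_int_ceiling_le_add_one[of "100 / \<beta> ^ 3"] b by (simp add: J_def)
    also have "\<dots> \<le> 100 / \<beta> ^ 3 + 1 / \<beta> ^ 3" by (intro add_left_mono p1)
    finally show ?thesis by (simp flip: add_divide_distrib)
  qed
  have Q1: "real Q \<ge> 220341600 / \<beta> ^ 9" unfolding Q_def by (rule real_nat_ceiling_ge)
  have Q2: "real Q \<le> 220341601 / \<beta> ^ 9"
  proof -
    have "real Q \<le> 220341600 / \<beta> ^ 9 + 1"
      using of_int_ceiling_le_add_one[of "220341600 / \<beta> ^ 9"] b by (simp add: Q_def)
    also have "\<dots> \<le> 220341600 / \<beta> ^ 9 + 1 / \<beta> ^ 9" by (intro add_left_mono p1)
    finally show ?thesis by (simp flip: add_divide_distrib)
  qed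
  have "100 / \<beta> ^ 3 > 0" "220341600 / \<beta> ^ 9 > 0" using b by simp_all
  then have "J \<ge> 1" "Q \<ge> 1" using J1 Q1 by linarith+
  have "real J * (2 * real J * ln (real (Q\<^sup>2)) + 32) \<le> 36 * (real J)\<^sup>2 * real Q"
  proof -
    have "ln (real (Q\<^sup>2)) \<le> 2 * real Q"
      using \<open>Q \<ge> 1\<close> ln_bound[of "real Q"] by (simp add: ln_realpow)
    then have "real J * (2 * real J * ln (real (Q\<^sup>2)) + 32) \<le> real J * (2 * real J * (2 * real Q) + 32 * (real J * real Q))"
      using \<open>J \<ge> 1\<close> \<open>Q \<ge> 1\<close> mult_mono[of 1 "real J" 1 "real Q"]
      by (intro mult_left_mono add_mono) auto
    then show ?thesis by (simp add: power2_eq_square algebra_simps)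
  qed
  moreover have "21600 * (real J)\<^sup>2 \<le> \<beta> ^ 3 * real Q"
  proof -
    have "21600 * (real J)\<^sup>2 \<le> 21600 * (101 / \<beta> ^ 3)\<^sup>2" using J2 by (intro mult_left_mono power_mono) auto
    also have "\<dots> = \<beta> ^ 3 * (220341600 / \<beta> ^ 9)"
      using b by (simp add: field_simps power2_eq_square flip: power_add)
    also have "\<dots> \<le> \<beta> ^ 3 * real Q" using Q1 b by (intro mult_left_mono) auto
    finally show ?thesis .
  qed
  then have "21600 * (real J)\<^sup>2 * real Q \<le> \<beta> ^ 3 * real Q * real Q" by (rule mult_right_mono) simp
  ultimately have "600 * (real J * (2 * real J * ln (real (Q\<^sup>2)) + 32)) \<le> \<beta> ^ 3 * real (Q\<^sup>2)"
    by (simp add: power2_eq_square)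
  then have "6 * (real J * (2 * real J * ln (real (Q\<^sup>2)) + 32)) / real (Q\<^sup>2) \<le> \<beta> ^ 3 / 100"
    using \<open>Q \<ge> 1\<close> by (simp add: divide_le_eq)
  moreover have "real J * (\<beta> ^ 3 / 100) \<ge> 1" using J1 b by (simp add: field_simps)
  ultimately have "ln (of_int N) \<le> real (Q\<^sup>2) + 4 / \<beta>\<^sup>2"
    using \<open>J \<ge> 1\<close> \<open>Q \<ge> 1\<close> by (intro group_order_bound) auto
  also have "real (Q\<^sup>2) \<le> (220341601 / \<beta> ^ 9)\<^sup>2" using Q2 by (simp add: power_mono)
  also have "\<dots> = 220341601\<^sup>2 / \<beta> ^ 18" by (simp add: power_divide flip: power_mult)
  also have "4 / \<beta>\<^sup>2 \<le> 4 / \<beta> ^ 18" using b by (intro divide_left_mono power_decreasing) auto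
  finally show ?thesis by (simp add: add_divide_distrib)
qed

end

subsection \<open>Skew corners\<close>

text \<open>The square is placed in the cyclic group of order \<open>4 * n\<close>. With the factor
  8, \<open>\<beta> * N\<close> equals \<open>card A / (2 * n)\<close>, half the average column
  size.\<close>

lemma skew_corner_free_ln_bound:
  assumes "n \<ge> 1" "A \<subseteq> {1..int n} \<times> {1..int n}" "skew_corner_free A" "A \<noteq> {}"
  shows "ln (real n) \<le> (220341601\<^sup>2 + 4) / (real (card A) / (8 * (real n)\<^sup>2)) ^ 18"
proof -
  \<comment> \<open>large enough that no relation between two columns and a difference wraps around\<close>
  define N where "N = 4 * int n"
  define \<beta> where "\<beta> = real (card A) / (8 * (real n)\<^sup>2)"
  define col where "col x = {y. (x, y) \<in> A}" for x
  \<comment> \<open>The popular columns: the others hold at most half of \<open>A\<close>, so with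
    at most \<open>n\<close> points per column at least \<open>card A / (2 * n)\<close> columns are
    popular.\<close>
  define X0 where "X0 = {x \<in> {1..int n}. real (card (col x)) \<ge> \<beta> * of_int N}"
  have fin: "finite A" using assms(2) finite_subset by blast
  have N0: "N > 0" using assms(1) by (simp add: N_def)
  have col_sub: "col x \<subseteq> {1..int n}" for x using assms(2) by (auto simp: col_def)
  have \<beta>N: "\<beta> * of_int N * (2 * real n) = real (card A)"
    using assms(1) by (simp add: \<beta>_def N_def field_simps power2_eq_square)
  have X0: "\<beta> * of_int N \<le> real (card X0)"
  proof -
    have "A = Sigma {1..int n} col" using assms(2) by (auto simp: col_def)
    moreover have "finite (col x)" for x using col_sub finite_subset by blast
    ultimately have "card A = (\<Sum>x\<in>{1..int n}. card (col x))"
      using card_SigmaI[of "{1..int n}" col] by simp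
    then have "real (card A) = (\<Sum>x\<in>{1..int n}. real (card (col x)))" by simp
    also have "\<dots> \<le> (\<Sum>x\<in>{1..int n}. of_bool (x \<in> X0) * real n + \<beta> * of_int N)"
    proof (intro sum_mono)
      fix x assume x: "x \<in> {1..int n}"
      show "real (card (col x)) \<le> of_bool (x \<in> X0) * real n + \<beta> * of_int N"
      proof (cases "x \<in> X0")
        case True
        have "card (col x) \<le> card {1..int n}" using col_sub by (intro card_mono) auto
        moreover have "\<beta> * of_int N \<ge> 0" using N0 by (simp add: \<beta>_def)
        ultimately show ?thesis using True by simp
      next
        case False
        then show ?thesis using x by (simp add: X0_def)
      qed
    qed
    also have "\<dots> = real (card X0) * real n + real n * (\<beta> * of_int N)"
    proof -
      have "{1..int n} \<inter> X0 = X0" by (auto simp: X0_def)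
      then show ?thesis by (simp add: sum.distrib flip: sum_distrib_right)
    qed
    finally have "\<beta> * of_int N * real n \<le> real (card X0) * real n"
      using \<beta>N by (simp add: algebra_simps)
    then show ?thesis using assms(1) by simp
  qed
  interpret sparse_columns N "{t. t mod N \<in> X0}" "\<lambda>x. col (x mod N)" \<beta>
  proof
    show "N > 0" by (rule N0)
    show "\<beta> > 0" using assms(1,4) fin by (simp add: \<beta>_def card_gt_0_iff)
    have "{t. t mod N \<in> X0} \<inter> {0..<N} = X0"
      by (auto simp: X0_def N_def)
    then show "\<beta> * of_int N \<le> real (card ({t. t mod N \<in> X0} \<inter> {0..<N}))" using X0 by simp
    show "(t + N \<in> {t. t mod N \<in> X0}) = (t \<in> {t. t mod N \<in> X0})" for t by simp
    show "col (x mod N) \<subseteq> {0..<N}" for x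
      using col_sub[of "x mod N"] assms(1) by (force simp: N_def)
    show "\<beta> * of_int N \<le> real (card (col (x mod N)))" if "x \<in> {t. t mod N \<in> X0}" for x
      using that by (simp add: X0_def)
    show "b = b'" if x: "x \<in> {t. t mod N \<in> X0}" and b: "b \<in> col (x mod N)" "b' \<in> col (x mod N)"
      and x': "x + (b - b') \<in> {t. t mod N \<in> X0}" for x b b'
    proof (rule ccontr)
      assume "b \<noteq> b'"
      define y z where "y = x mod N" and "z = (x + (b - b')) mod N"
      have y: "y \<in> X0" and z: "z \<in> X0" using x x' by (auto simp: y_def z_def)
      have "z mod N = (y + (b - b')) mod N" by (simp add: y_def z_def mod_simps)
      then have "N dvd (y + (b - b')) - z" by (metis mod_eq_dvd_iff)
      \<comment> \<open>Two differences of elements of \<open>[n]\<close> add up to less than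
        \<open>2 * n\<close> in absolute value, so the congruence is an equality of
        integers.\<close>
      moreover have "\<bar>(y + (b - b')) - z\<bar> < N"
      proof -
        have "b \<in> {1..int n}" "b' \<in> {1..int n}" using b col_sub by blast+
        moreover have "y \<in> {1..int n}" "z \<in> {1..int n}" using y z by (auto simp: X0_def)
        ultimately show ?thesis by (auto simp: N_def)
      qed
      ultimately have zy: "z = y + (b - b')"
        using zdvd_not_zless[of "\<bar>(y + (b - b')) - z\<bar>" N] by auto
      have "0 < \<beta> * of_int N" using \<open>\<beta> > 0\<close> N0 by simp
      also have "\<dots> \<le> real (card (col z))" using z by (simp add: X0_def)
      finally have "real (card (col z)) > 0" .
      \<comment> \<open>The third point of a skew corner may have any ordinate, so a non-empty
        column over \<open>z\<close> is enough.\<close>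
      then have "col z \<noteq> {}" by auto
      then obtain y' where "(z, y') \<in> A" by (auto simp: col_def)
      then have "skew_corner y b' y' (b - b') \<subseteq> A"
        using b zy by (auto simp: skew_corner_def col_def y_def)
      then show False using assms(3) \<open>b \<noteq> b'\<close> unfolding skew_corner_free_def
        by (metis right_minus_eq)
    qed
  qed
  have "ln (real n) \<le> ln (of_int N)" using assms(1) by (simp add: N_def)
  then show ?thesis using ln_group_order_le by (simp add: \<beta>_def)
qed

section \<open>The asymptotic bound\<close>

theorem theorem2:
  shows "\<exists>c\<^sub>2 :: real. c\<^sub>2 > 0 \<and>
    (\<lambda>n. real (max_skew_corner_free n)) \<in> O(\<lambda>n. (real n)\<^sup>2 / ln (real n) powr c\<^sub>2)"
proof (intro exI conjI)
  define C :: real where "C = 220341601\<^sup>2 + 4"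
  have C: "C \<ge> 1" by (simp add: C_def)
  \<comment> \<open>The exponent \<open>1 / 18\<close> inverts the eighteenth power of the density;
    \<open>n \<ge> 2\<close> makes the logarithm positive.\<close>
  have bound: "real (max_skew_corner_free n) \<le> 8 * C * ((real n)\<^sup>2 / ln (real n) powr (1 / 18))"
    if n: "n \<ge> 2" for n
  proof -
    let ?F = "{A. A \<subseteq> {1..int n} \<times> {1..int n} \<and> skew_corner_free A}"
    have L: "ln (real n) > 0" using n by simp
    have "max_skew_corner_free n \<in> card ` ?F"
      unfolding max_skew_corner_free_def using finite_skew_corner_free_subsets skew_corner_free_empty
      by (intro Max_in) auto
    then obtain A where A: "A \<subseteq> {1..int n} \<times> {1..int n}" "skew_corner_free A"
      and m: "max_skew_corner_free n = card A" by auto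
    show ?thesis
    \<comment> \<open>The density \<open>b\<close> is used as a divisor, so the empty set is treated
      apart.\<close>
    proof (cases "A = {}")
      case True
      then show ?thesis using m C by simp
    next
      case False
      define b where "b = real (card A) / (8 * (real n)\<^sup>2)"
      have "finite A" using A(1) finite_subset by blast
      then have b: "b > 0" using False n by (simp add: b_def card_gt_0_iff)
      have "ln (real n) \<le> C / b ^ 18"
        unfolding C_def b_def using A n False by (intro skew_corner_free_ln_bound) auto
      then have "ln (real n) powr (1 / 18) \<le> (C / b ^ 18) powr (1 / 18)"
        using L by (intro powr_mono2) auto
      also have "\<dots> = C powr (1 / 18) / b"
      proof -
        have "(b ^ 18) powr (1 / 18) = (b powr 18) powr (1 / 18)"
          using b powr_realpow[of b 18] by simp
        also have "\<dots> = b" using b by (simp only: powr_powr) simp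
        finally show ?thesis using b C by (simp add: powr_divide)
      qed
      also have "\<dots> \<le> C / b"
        using b C powr_mono[of "1 / 18" 1 C] by (simp add: divide_right_mono)
      finally have "ln (real n) powr (1 / 18) * b \<le> C" using b by (simp add: field_simps)
      then have "b \<le> C / ln (real n) powr (1 / 18)" using L by (simp add: field_simps)
      then have "b * (8 * (real n)\<^sup>2) \<le> C / ln (real n) powr (1 / 18) * (8 * (real n)\<^sup>2)"
        by (rule mult_right_mono) simp
      moreover have "b * (8 * (real n)\<^sup>2) = real (card A)" using n by (simp add: b_def)
      ultimately show ?thesis by (simp add: m mult_ac)
    qed
  qed
  show "(\<lambda>n. real (max_skew_corner_free n)) \<in> O(\<lambda>n. (real n)\<^sup>2 / ln (real n) powr (1 / 18))"
  proof (rule bigoI[where c = "8 * C"])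
    show "\<forall>\<^sub>F n in sequentially. norm (real (max_skew_corner_free n))
        \<le> 8 * C * norm ((real n)\<^sup>2 / ln (real n) powr (1 / 18))"
      using eventually_ge_at_top[of 2] by eventually_elim (use bound in simp)
  qed
qed simp

end
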